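(* Let $D\subset\mathbb{C}$ be an open set, let $\Omega\subset\mathbb{C}$ be a domain with $\Omega\supset D$, and let $f:D\to D$ be holomorphic. Let $U\in\mathcal{U}_0(D,\Omega,f)$. Then the set of all functions in $H(\Omega)$ which are $H(U)$-universal for $C_f$ is a comeager set in $H(\Omega)$.
   Context: $\mathbb{N}=\{1,2,\dots\}$; $f^n$ is the $n$-th iterate of $f$. For an open set $W\subset\mathbb{C}$, $H(W)$ is the Fréchet space of complex-valued holomorphic functions on $W$ with the topology of locally uniform convergence. $C_f$ denotes the composition operator $g\mapsto g\circ f$. A hole of a set $M\subset\mathbb{C}$ is a component $H$ of $\mathbb{C}_\infty\setminus M$ with $\infty\notin H$, where $\mathbb{C}_\infty=\mathbb{C}\cup\{\infty\}$ is the extended plane with the chordal metric. For $M\subset\mathbb{C}$, $\mathcal{U}_0(M)$ is the set of all non-empty subsets $U\subset M$ which are open in $\mathbb{C}$ and have no holes. $\partial_\infty\Omega$ denotes the boundary of $\Omega$ in $\mathbb{C}_\infty$, and $\mathrm{dist}$ to it is taken with respect to the chordal metric. $\mathcal{U}_0(D,\Omega,f)$ is the set of all $U\in\mathcal{U}_0(D)$ such that (1) $f^n|_U\to\partial_\infty\Omega$ locally uniformly, i.e. the sequence $(\mathrm{dist}(f^n(\cdot),\partial_\infty\Omega))_{n\in\mathbb{N}}$ converges to $0$ locally uniformly on $U$, and (2) each iterate $f^n$ is injective on $U$. For an open set $U\subset D$, a function $g\in H(\Omega)$ is called $H(U)$-universal for $C_f$ if $\{g\circ f^n|_U:n\in\mathbb{N}\}$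 is dense in $H(U)$. A subset of a Baire space is comeager if it contains a dense $G_\delta$-set. *)

theory Defs
  imports "HOL-Analysis.Analysis"
begin

section \<open>The extended plane with the chordal metric\<close>

datatype ecomplex = Fin complex | Infty

text \<open>Inverse stereographic projection onto the unit sphere of
  \<open>\<complex> \<times> \<real>\<close>; the chordal distance is the length of the chord between
  the images.\<close>

fun stereo :: "ecomplex \<Rightarrow> complex \<times> real" where
  "stereo (Fin z) = (of_real (2 / (1 + (cmod z)\<^sup>2)) * z, ((cmod z)\<^sup>2 - 1) / (1 + (cmod z)\<^sup>2))"
| "stereo Infty = (0, 1)"

lemma one_plus_sq_pos: "1 + (cmod z)\<^sup>2 > 0"
  by (simp add: add_pos_nonneg)

lemma stereo_snd_ne_1: "((cmod z)\<^sup>2 - 1) / (1 + (cmod z)\<^sup>2) \<noteq> 1"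
  using one_plus_sq_pos[of z] by (simp add: divide_simps)

lemma inj_stereo: "inj stereo"
proof (rule injI)
  fix p q assume eq: "stereo p = stereo q"
  show "p = q"
  proof (cases p; cases q)
    fix z w assume pq: "p = Fin z" "q = Fin w"
    have pos: "1 + (cmod z)\<^sup>2 > 0" "1 + (cmod w)\<^sup>2 > 0"
      by (rule one_plus_sq_pos)+
    have "((cmod z)\<^sup>2 - 1) / (1 + (cmod z)\<^sup>2) = ((cmod w)\<^sup>2 - 1) / (1 + (cmod w)\<^sup>2)"
      using eq pq by simp
    hence "((cmod z)\<^sup>2 - 1) * (1 + (cmod w)\<^sup>2) = ((cmod w)\<^sup>2 - 1) * (1 + (cmod z)\<^sup>2)"
      using pos by (simp add: frac_eq_eq)
    hence sq: "(cmod z)\<^sup>2 = (cmod w)\<^sup>2" by (simp add: algebra_simps)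
    have "of_real (2 / (1 + (cmod z)\<^sup>2)) * z = of_real (2 / (1 + (cmod z)\<^sup>2)) * w"
      using eq pq sq by simp
    moreover have "complex_of_real (2 / (1 + (cmod z)\<^sup>2)) \<noteq> 0"
      using pos by (simp only: of_real_eq_0_iff) simp
    ultimately show ?thesis using pq by (simp only: mult_cancel_left) simp
  qed (use eq stereo_snd_ne_1 in \<open>auto dest: sym\<close>)
qed

instantiation ecomplex :: metric_space
begin

definition dist_ecomplex :: "ecomplex \<Rightarrow> ecomplex \<Rightarrow> real" where
  "dist p q = dist (stereo p) (stereo q)"

definition uniformity_ecomplex :: "(ecomplex \<times> ecomplex) filter" where
  "(uniformity :: (ecomplex \<times> ecomplex) filter) = (INF e\<in>{0 <..}. principal {(p, q). dist p q < e})"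

definition open_ecomplex :: "ecomplex set \<Rightarrow> bool" where
  "open (S :: ecomplex set) \<longleftrightarrow> (\<forall>p\<in>S. \<forall>\<^sub>F (p', q) in uniformity. p' = p \<longrightarrow> q \<in> S)"

instance
proof
  fix p q r :: ecomplex and S :: "ecomplex set"
  show "dist p q = 0 \<longleftrightarrow> p = q"
    using inj_stereo by (auto simp: dist_ecomplex_def inj_eq)
  show "dist p q \<le> dist p r + dist q r"
    unfolding dist_ecomplex_def by (rule dist_triangle2)
qed (rule uniformity_ecomplex_def open_ecomplex_def)+

end

lemma dist_Fin_Infty: "dist (Fin z) Infty = 2 / sqrt (1 + (cmod z)\<^sup>2)"
proof -
  define s where "s = 1 + (cmod z)\<^sup>2"
  have s: "s > 0" "(cmod z)\<^sup>2 = s - 1"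
    using one_plus_sq_pos[of z] by (simp_all add: s_def)
  have "(dist (Fin z) Infty)\<^sup>2 = (cmod (of_real (2 / s) * z))\<^sup>2 + ((s - 2) / s - 1)\<^sup>2"
    unfolding dist_ecomplex_def stereo.simps dist_Pair_Pair
    by (simp add: dist_norm s_def norm_mult norm_divide)
  also have "(cmod (of_real (2 / s) * z))\<^sup>2 = (2 / s)\<^sup>2 * (s - 1)"
    by (simp only: norm_mult power_mult_distrib s(2) norm_of_real) (simp add: power_divide)
  also have "(2 / s)\<^sup>2 * (s - 1) + ((s - 2) / s - 1)\<^sup>2 = (2 / sqrt s)\<^sup>2"
    using s(1) by (simp add: field_simps power2_eq_square)
  finally show ?thesis
    using s(1) by (simp add: s_def power2_eq_iff_nonneg)
qed

lemma dist_Fin_Fin: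
  "dist (Fin z) (Fin w) = 2 * cmod (z - w) / (sqrt (1 + (cmod z)\<^sup>2) * sqrt (1 + (cmod w)\<^sup>2))"
proof -
  define s t where "s = 1 + (cmod z)\<^sup>2" and "t = 1 + (cmod w)\<^sup>2"
  have s: "s > 0" "(cmod z)\<^sup>2 = s - 1" and t: "t > 0" "(cmod w)\<^sup>2 = t - 1"
    using one_plus_sq_pos[of z] one_plus_sq_pos[of w] by (simp_all add: s_def t_def)
  define c where "c = Re z * Re w + Im z * Im w"
  have eq: "(cmod (of_real a * z - of_real b * w))\<^sup>2 = a\<^sup>2 * (s - 1) + b\<^sup>2 * (t - 1) - 2 * a * b * c"
    for a b :: real
    by (simp flip: s(2) t(2) add: c_def cmod_power2) (simp add: power2_eq_square algebra_simps)
  have "(dist (Fin z) (Fin w))\<^sup>2 =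
      (cmod (of_real (2 / s) * z - of_real (2 / t) * w))\<^sup>2 + ((s - 2) / s - (t - 2) / t)\<^sup>2"
    unfolding dist_ecomplex_def stereo.simps dist_Pair_Pair
    by (simp add: dist_norm s_def t_def norm_divide)
  also have "\<dots> = 4 * (cmod (of_real 1 * z - of_real 1 * w))\<^sup>2 / (s * t)"
    unfolding eq using s(1) t(1) by (simp add: field_simps power2_eq_square)
  also have "\<dots> = (2 * cmod (z - w) / (sqrt s * sqrt t))\<^sup>2"
    using s(1) t(1) by (simp add: power_divide power_mult_distrib)
  finally show ?thesis
    using s(1) t(1) by (simp add: s_def t_def power2_eq_iff_nonneg)
qed


section \<open>Sets without holes\<close>

definition is_hole :: "complex set \<Rightarrow> ecomplex set \<Rightarrow> bool" where
  "is_hole M H \<longleftrightarrow> H \<in> components (UNIV - Fin ` M) \<and> Infty \<notin> H"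

definition U0 :: "complex set \<Rightarrow> complex set set" where
  "U0 M = {U. U \<noteq> {} \<and> U \<subseteq> M \<and> open U \<and> (\<nexists>H. is_hole U H)}"

text \<open>For non-empty \<open>\<Omega> \<subseteq> \<complex>\<close> the set \<open>boundary_inf \<Omega>\<close> is non-empty because the
  extended plane is connected and \<open>Infty \<notin> Fin ` \<Omega>\<close>; so the convention
  \<open>infdist x {} = 0\<close> is not used in that case.\<close>

definition boundary_inf :: "complex set \<Rightarrow> ecomplex set" where
  "boundary_inf \<Omega> = frontier (Fin ` \<Omega>)"

definition locally_uniform_limit ::
    "complex set \<Rightarrow> (nat \<Rightarrow> complex \<Rightarrow> real) \<Rightarrow> (complex \<Rightarrow> real) \<Rightarrow> bool" where
  "locally_uniform_limit U F l \<longleftrightarrow>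
     (\<forall>z\<in>U. \<exists>V. open V \<and> z \<in> V \<and> V \<subseteq> U \<and> uniform_limit V F l sequentially)"

definition U0_dyn :: "complex set \<Rightarrow> complex set \<Rightarrow> (complex \<Rightarrow> complex) \<Rightarrow> complex set set" where
  "U0_dyn D \<Omega> f = {U \<in> U0 D.
     locally_uniform_limit U (\<lambda>n z. infdist (Fin ((f ^^ n) z)) (boundary_inf \<Omega>)) (\<lambda>_. 0) \<and>
     (\<forall>n\<ge>1. inj_on (f ^^ n) U)}"


section \<open>The space of holomorphic functions\<close>

text \<open>A function on \<open>W\<close> is represented by its extension with value \<open>undefined\<close> outside \<open>W\<close>,
  so that equality in the space is equality on \<open>W\<close>.\<close>

definition holo_space :: "complex set \<Rightarrow> (complex \<Rightarrow> complex) set" where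
  "holo_space W = {g. g holomorphic_on W} \<inter> extensional W"

definition holo_nbhd :: "complex set \<Rightarrow> (complex \<Rightarrow> complex) \<Rightarrow> complex set \<Rightarrow> real \<Rightarrow> (complex \<Rightarrow> complex) set" where
  "holo_nbhd W g K e = {h \<in> holo_space W. \<forall>z\<in>K. cmod (h z - g z) < e}"

text \<open>Locally uniform convergence on the open set \<open>W\<close> is uniform convergence on compact subsets.\<close>

definition holo_open :: "complex set \<Rightarrow> (complex \<Rightarrow> complex) set \<Rightarrow> bool" where
  "holo_open W G \<longleftrightarrow> G \<subseteq> holo_space W \<and>
     (\<forall>g\<in>G. \<exists>K e. compact K \<and> K \<subseteq> W \<and> e > 0 \<and> holo_nbhd W g K e \<subseteq> G)"

definition holo_topology :: "complex set \<Rightarrow> (complex \<Rightarrow> complex) topology" where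
  "holo_topology W = topology (holo_open W)"

lemma istopology_holo_open: "istopology (holo_open W)"
  unfolding istopology_def
proof (intro conjI allI impI)
  fix S T assume ST: "holo_open W S" "holo_open W T"
  show "holo_open W (S \<inter> T)"
    unfolding holo_open_def
  proof (intro conjI ballI)
    show "S \<inter> T \<subseteq> holo_space W" using ST by (auto simp: holo_open_def)
    fix g assume "g \<in> S \<inter> T"
    then obtain K1 e1 K2 e2 where
      "compact K1" "K1 \<subseteq> W" "e1 > 0" "holo_nbhd W g K1 e1 \<subseteq> S"
      "compact K2" "K2 \<subseteq> W" "e2 > 0" "holo_nbhd W g K2 e2 \<subseteq> T"
      using ST unfolding holo_open_def by blast
    moreover have "holo_nbhd W g (K1 \<union> K2) (min e1 e2) \<subseteq> holo_nbhd W g K1 e1 \<inter> holo_nbhd W g K2 e2"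
      by (auto simp: holo_nbhd_def)
    ultimately show "\<exists>K e. compact K \<and> K \<subseteq> W \<and> e > 0 \<and> holo_nbhd W g K e \<subseteq> S \<inter> T"
      by (intro exI[of _ "K1 \<union> K2"] exI[of _ "min e1 e2"]) (auto intro: compact_Un)
  qed
next
  fix \<K> assume "\<forall>S\<in>\<K>. holo_open W S"
  then show "holo_open W (\<Union>\<K>)"
    unfolding holo_open_def by (meson Sup_least Union_upper UnionE order_trans)
qed

lemma openin_holo_topology: "openin (holo_topology W) = holo_open W"
  by (simp add: holo_topology_def istopology_holo_open topology_inverse')

lemma topspace_holo_topology: "topspace (holo_topology W) = holo_space W"
proof -
  have "holo_open W (holo_space W)"
    unfolding holo_open_def holo_nbhd_def
    by (auto intro!: exI[of _ "{}"] exI[of _ "1::real"])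
  then show ?thesis
    unfolding topspace_def openin_holo_topology holo_open_def by blast
qed


section \<open>Universality and comeager sets\<close>

definition universal_on ::
    "complex set \<Rightarrow> complex set \<Rightarrow> (complex \<Rightarrow> complex) \<Rightarrow> (complex \<Rightarrow> complex) \<Rightarrow> bool" where
  "universal_on \<Omega> U f g \<longleftrightarrow> g \<in> holo_space \<Omega> \<and>
     holo_topology U closure_of {restrict (g \<circ> (f ^^ n)) U | n. n \<ge> 1} = holo_space U"

definition comeager_in :: "'a topology \<Rightarrow> 'a set \<Rightarrow> bool" where
  "comeager_in X A \<longleftrightarrow> A \<subseteq> topspace X \<and>
     (\<exists>S\<subseteq>A. gdelta_in X S \<and> X closure_of S = topspace X)"

end

theory Submission
  imports Defs "HOL-Complex_Analysis.Complex_Analysis"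
begin

text \<open>Universality of \<open>g\<close> means that \<open>g\<close> lies in all of the sets
\<open>{g. \<exists>n\<ge>1. \<bar>g \<circ> f^n - p\<bar> < \<epsilon> on L}\<close>, where \<open>p\<close> runs through a countable dense set of
polynomials, \<open>L\<close> through a compact exhaustion of \<open>U\<close> and \<open>\<epsilon>\<close> through the numbers \<open>1/q\<close>. These are
countably many open sets, so by a Baire argument (\<open>comeager_in_holo_topologyI\<close>) it suffices
that each is dense: given \<open>g \<in> H(\<Omega>)\<close> and a compact \<open>K \<subseteq> \<Omega>\<close>, some \<open>h \<in> H(\<Omega>)\<close> must be close to \<open>g\<close> on
\<open>K\<close> and close to \<open>p \<circ> (f^n)^{-1}\<close> on \<open>f^n(L)\<close>.

This is an approximation problem of Runge type. Enlarge \<open>K\<close> so that every component of its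
complement is unbounded or leaves \<open>\<Omega>\<close> (\<open>runge_compact_hull\<close>). Since \<open>U\<close> has no holes, its
components are simply connected (\<open>simply_connected_components_of_no_holes\<close>), and finitely many
Riemann maps cover \<open>L\<close> by closed conformal discs inside \<open>U\<close>. For large \<open>n\<close> the map \<open>f^n\<close> carries
these discs off \<open>K\<close>, because their images tend to the boundary of \<open>\<Omega>\<close> (\<open>iterates_leave_compact\<close>).
As \<open>f^n\<close> is injective, the images are again disjoint closed discs, and Janiszewski's theorem shows
that adding them to \<open>K\<close> creates no new obstruction (\<open>runge_compact_Un_disc\<close>).

The approximating function comes from an explicit Cauchy integral. If \<open>\<Psi>\<close> is conformal on a disc of
radius \<open>s > 1\<close> and \<open>1 < \<rho> < s\<close>, the Cauchy integral over the image curve \<open>\<Psi>(\<bar>w\<bar> = \<rho>)\<close>, pulled back to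
the circle, equals the given function on \<open>\<Psi>(\<bar>w\<bar> \<le> 1)\<close> and vanishes off \<open>\<Psi>(\<bar>w\<bar> < s)\<close>. It is a
limit of Riemann sums of simple poles, and those poles can be pushed out of \<open>\<Omega>\<close> or to infinity
(\<open>runge_compact_pole_approximable\<close>). The same approximation with \<open>\<Omega> = \<complex>\<close> and \<open>K = {}\<close> gives
the density of the polynomials in \<open>H(U)\<close>.\<close>

section \<open>Uniform approximation by holomorphic functions\<close>

definition holo_approximable :: "complex set \<Rightarrow> complex set \<Rightarrow> (complex \<Rightarrow> complex) set" where
  "holo_approximable \<Omega> X =
     {F. \<forall>e>0. \<exists>h. h holomorphic_on \<Omega> \<and> (\<forall>z\<in>X. cmod (F z - h z) < e)}"

lemma holo_approximableD:
  assumes "F \<in> holo_approximable \<Omega> X" "e > 0"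
  obtains h where "h holomorphic_on \<Omega>" "\<And>z. z \<in> X \<Longrightarrow> cmod (F z - h z) < e"
  using assms unfolding holo_approximable_def by blast

lemma holo_approximable_superset: "F holomorphic_on \<Omega> \<Longrightarrow> F \<in> holo_approximable \<Omega> X"
  unfolding holo_approximable_def by auto

lemma holo_approximable_cong:
  assumes "F \<in> holo_approximable \<Omega> X" "\<And>z. z \<in> X \<Longrightarrow> F z = G z"
  shows "G \<in> holo_approximable \<Omega> X"
  using assms unfolding holo_approximable_def by auto

lemma holo_approximable_uniform_limit:
  assumes "\<And>e. e > 0 \<Longrightarrow> \<exists>F\<in>holo_approximable \<Omega> X. \<forall>z\<in>X. cmod (G z - F z) < e"
  shows "G \<in> holo_approximable \<Omega> X"
  unfolding holo_approximable_def
proof (intro CollectI allI impI)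
  fix e :: real assume "e > 0"
  hence e2: "e / 2 > 0" by simp
  obtain F where F: "F \<in> holo_approximable \<Omega> X" "\<forall>z\<in>X. cmod (G z - F z) < e / 2"
    using assms[OF e2] by blast
  obtain h where h: "h holomorphic_on \<Omega>" "\<And>z. z \<in> X \<Longrightarrow> cmod (F z - h z) < e / 2"
    using holo_approximableD[OF F(1) e2] by blast
  have "cmod (G z - h z) < e" if "z \<in> X" for z
    using norm_triangle_ineq[of "G z - F z" "F z - h z"] F(2) h(2)[OF that] that by fastforce
  with h(1) show "\<exists>h. h holomorphic_on \<Omega> \<and> (\<forall>z\<in>X. cmod (G z - h z) < e)" by blast
qed

lemma holo_approximable_add:
  assumes "F \<in> holo_approximable \<Omega> X" "G \<in> holo_approximable \<Omega> X"
  shows "(\<lambda>z. F z + G z) \<in> holo_approximable \<Omega> X"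
  unfolding holo_approximable_def
proof (intro CollectI allI impI)
  fix e :: real assume "e > 0"
  hence e2: "e / 2 > 0" by simp
  obtain h where h: "h holomorphic_on \<Omega>" "\<And>z. z \<in> X \<Longrightarrow> cmod (F z - h z) < e / 2"
    using holo_approximableD[OF assms(1) e2] by blast
  obtain k where k: "k holomorphic_on \<Omega>" "\<And>z. z \<in> X \<Longrightarrow> cmod (G z - k z) < e / 2"
    using holo_approximableD[OF assms(2) e2] by blast
  have "cmod ((F z + G z) - (h z + k z)) < e" if "z \<in> X" for z
    using norm_triangle_ineq[of "F z - h z" "G z - k z"] h(2)[OF that] k(2)[OF that]
    by (simp add: algebra_simps)
  moreover have "(\<lambda>z. h z + k z) holomorphic_on \<Omega>"
    using h(1) k(1) by (intro holomorphic_intros)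
  ultimately show "\<exists>h. h holomorphic_on \<Omega> \<and> (\<forall>z\<in>X. cmod ((F z + G z) - h z) < e)"
    by blast
qed

lemma holo_approximable_bounded:
  assumes X: "compact X" "X \<subseteq> \<Omega>" and F: "F \<in> holo_approximable \<Omega> X"
  obtains B where "B > 0" "\<And>z. z \<in> X \<Longrightarrow> cmod (F z) \<le> B"
proof -
  obtain h where h: "h holomorphic_on \<Omega>" "\<And>z. z \<in> X \<Longrightarrow> cmod (F z - h z) < 1"
    using holo_approximableD[OF F zero_less_one] by blast
  have "compact (h ` X)"
    using X h(1) by (intro compact_continuous_image)
      (auto intro: holomorphic_on_imp_continuous_on holomorphic_on_subset)
  then obtain B where B: "B > 0" "\<And>z. z \<in> X \<Longrightarrow> cmod (h z) \<le> B"
    using compact_imp_bounded bounded_pos by (metis imageI)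
  have "cmod (F z) \<le> B + 1" if "z \<in> X" for z
    using norm_triangle_ineq[of "F z - h z" "h z"] B(2)[OF that] h(2)[OF that] by simp
  with B(1) show ?thesis using that[of "B + 1"] by simp
qed

lemma holo_approximable_mult:
  assumes X: "compact X" "X \<subseteq> \<Omega>"
    and F: "F \<in> holo_approximable \<Omega> X" and G: "G \<in> holo_approximable \<Omega> X"
  shows "(\<lambda>z. F z * G z) \<in> holo_approximable \<Omega> X"
  unfolding holo_approximable_def
proof (intro CollectI allI impI)
  fix e :: real assume e: "e > 0"
  obtain A where A: "A > 0" "\<And>z. z \<in> X \<Longrightarrow> cmod (F z) \<le> A"
    using holo_approximable_bounded[OF X F] by metis
  obtain B where B: "B > 0" "\<And>z. z \<in> X \<Longrightarrow> cmod (G z) \<le> B"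
    using holo_approximable_bounded[OF X G] by metis
  define d1 where "d1 = e / (2 * B)"
  have d1: "d1 > 0" using e B by (simp add: d1_def)
  obtain h where h: "h holomorphic_on \<Omega>" "\<And>z. z \<in> X \<Longrightarrow> cmod (F z - h z) < d1"
    using holo_approximableD[OF F d1] by blast
  \<comment> \<open>the bound \<open>A + d1\<close> for \<open>h\<close> is available only now, so \<open>k\<close> is chosen after \<open>h\<close>\<close>
  define d2 where "d2 = e / (2 * (A + d1))"
  have d2: "d2 > 0" using e A d1 by (simp add: d2_def)
  obtain k where k: "k holomorphic_on \<Omega>" "\<And>z. z \<in> X \<Longrightarrow> cmod (G z - k z) < d2"
    using holo_approximableD[OF G d2] by blast
  have "cmod (F z * G z - h z * k z) < e" if z: "z \<in> X" for z
  proof -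
    have hz: "cmod (h z) \<le> A + d1"
      using norm_triangle_ineq[of "F z" "h z - F z"] A(2)[OF z] h(2)[OF z]
      by (simp add: norm_minus_commute)
    have "cmod (F z * G z - h z * k z) = cmod ((F z - h z) * G z + h z * (G z - k z))"
      by (simp add: algebra_simps)
    also have "\<dots> \<le> cmod (F z - h z) * cmod (G z) + cmod (h z) * cmod (G z - k z)"
      by (metis norm_mult norm_triangle_ineq)
    also have "\<dots> \<le> cmod (F z - h z) * B + (A + d1) * cmod (G z - k z)"
      using B(2)[OF z] hz by (intro add_mono mult_left_mono mult_right_mono) auto
    also have "\<dots> < d1 * B + (A + d1) * d2"
      using h(2)[OF z] k(2)[OF z] A B d1 by (intro add_strict_mono mult_strict_left_mono mult_strict_right_mono) auto
    also have "\<dots> = e"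
    proof -
      have "d1 * B = e / 2" using B by (simp add: d1_def)
      moreover have "A + d1 \<noteq> 0" using A(1) d1 by linarith
      then have "(A + d1) * d2 = e / 2" unfolding d2_def by (metis mult.commute nonzero_mult_divide_mult_cancel_right2 times_divide_eq_right)
      ultimately show ?thesis by simp
    qed
    finally show ?thesis .
  qed
  moreover have "(\<lambda>z. h z * k z) holomorphic_on \<Omega>"
    using h(1) k(1) by (intro holomorphic_intros)
  ultimately show "\<exists>h. h holomorphic_on \<Omega> \<and> (\<forall>z\<in>X. cmod (F z * G z - h z) < e)"
    by blast
qed

text \<open>The partial sums of the geometric series lie in the algebra of approximable functions and converge
uniformly. Both ways of moving a pole, to a nearby point and in from infinity, are instances.\<close>

lemma holo_approximable_geometric:
  assumes X: "compact X" "X \<subseteq> \<Omega>" and q: "q \<in> holo_approximable \<Omega> X"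
    and small: "\<And>z. z \<in> X \<Longrightarrow> cmod (q z) \<le> 1/2"
  shows "(\<lambda>z. 1 / (1 - q z)) \<in> holo_approximable \<Omega> X"
proof (rule holo_approximable_uniform_limit)
  fix e :: real assume "e > 0"
  then obtain N where N: "(1/2::real) ^ N < e / 2"
    using real_arch_pow_inv[of "e/2" "1/2"] by auto
  have pow: "(\<lambda>z. q z ^ n) \<in> holo_approximable \<Omega> X" for n
  proof (induction n)
    case 0 show ?case by (simp add: holo_approximable_superset)
  next
    case (Suc n) then show ?case using holo_approximable_mult[OF X q Suc] by simp
  qed
  have sum: "(\<lambda>z. \<Sum>n<m. q z ^ n) \<in> holo_approximable \<Omega> X" for m
  proof (induction m)
    case 0 show ?case by (simp add: holo_approximable_superset)
  next
    case (Suc m) then show ?case using holo_approximable_add[OF Suc pow] by simp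
  qed
  have "cmod (1 / (1 - q z) - (\<Sum>n<N. q z ^ n)) < e" if z: "z \<in> X" for z
  proof -
    have half: "cmod (1 - q z) \<ge> 1/2"
      using norm_triangle_ineq2[of 1 "q z"] small[OF z] by simp
    hence ne: "1 - q z \<noteq> 0" by auto
    hence "1 / (1 - q z) - (\<Sum>n<N. q z ^ n) = q z ^ N / (1 - q z)"
      using geometric_sum[of "q z" N]
      by (simp add: sum_gp_strict divide_simps)
    hence "cmod (1 / (1 - q z) - (\<Sum>n<N. q z ^ n)) = cmod (q z) ^ N / cmod (1 - q z)"
      by (simp add: norm_divide norm_power)
    also have "\<dots> \<le> (1/2) ^ N / (1/2)"
      using half small[OF z] by (intro frac_le power_mono) auto
    also have "\<dots> < e" using N by simp
    finally show ?thesis .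
  qed
  with sum show "\<exists>F\<in>holo_approximable \<Omega> X. \<forall>z\<in>X. cmod (1 / (1 - q z) - F z) < e"
    by (intro bexI[of _ "\<lambda>z. \<Sum>n<N. q z ^ n"]) auto
qed

text \<open>An integral of approximable functions, depending continuously on the parameter, is a uniform limit
of Riemann sums. The proof bisects instead of handling partitions: on short intervals the integrand
may be frozen, and error bounds proportional to the length add up.\<close>

lemma holo_approximable_integral:
  fixes c \<gamma> :: "real \<Rightarrow> complex"
  assumes X: "compact X" "X \<subseteq> \<Omega>"
    and cont: "continuous_on {a..b} c" "continuous_on {a..b} \<gamma>" and ab: "a \<le> b"
    and off: "\<And>t. t \<in> {a..b} \<Longrightarrow> \<gamma> t \<notin> X"
    and pole: "\<And>t. t \<in> {a..b} \<Longrightarrow> (\<lambda>z. 1 / (\<gamma> t - z)) \<in> holo_approximable \<Omega> X"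
  shows "(\<lambda>z. integral {a..b} (\<lambda>t. c t / (\<gamma> t - z))) \<in> holo_approximable \<Omega> X"
proof (rule holo_approximable_uniform_limit)
  fix e :: real assume e: "e > 0"
  \<comment> \<open>the \<open>1\<close> covers the degenerate case \<open>a = b\<close>\<close>
  define \<epsilon> where "\<epsilon> = e / (b - a + 1)"
  have \<epsilon>: "\<epsilon> > 0" using e ab by (simp add: \<epsilon>_def)
  define G where "G = (\<lambda>(t, z). c t / (\<gamma> t - z))"
  have "continuous_on ({a..b} \<times> X) G"
    unfolding G_def case_prod_unfold
    by (intro continuous_intros continuous_on_compose2[OF cont(1) continuous_on_fst]
        continuous_on_compose2[OF cont(2) continuous_on_fst]) (use off in auto)
  hence "uniformly_continuous_on ({a..b} \<times> X) G"
    by (intro compact_uniformly_continuous compact_Times X) auto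
  then obtain d where d: "d > 0"
    "\<And>p q. p \<in> {a..b} \<times> X \<Longrightarrow> q \<in> {a..b} \<times> X \<Longrightarrow> dist q p < d \<Longrightarrow> dist (G q) (G p) < \<epsilon>"
    using \<epsilon> unfolding uniformly_continuous_on_def by metis
  have int: "(\<lambda>t. G (t, z)) integrable_on {u..v}" if "z \<in> X" "a \<le> u" "v \<le> b" for u v z
  proof -
    have "continuous_on {u..v} c" "continuous_on {u..v} \<gamma>"
      using cont that by (auto intro: continuous_on_subset)
    moreover have "\<gamma> t - z \<noteq> 0" if "t \<in> {u..v}" for t
      using off[of t] that \<open>z \<in> X\<close> \<open>a \<le> u\<close> \<open>v \<le> b\<close> by auto
    ultimately show ?thesis
      unfolding G_def by (auto intro!: integrable_continuous_real continuous_intros)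
  qed
  define P where "P = (\<lambda>u v. a \<le> u \<and> u \<le> v \<and> v \<le> b \<longrightarrow>
     (\<exists>F\<in>holo_approximable \<Omega> X. \<forall>z\<in>X. cmod (integral {u..v} (\<lambda>t. G (t, z)) - F z) \<le> \<epsilon> * (v - u)))"
  have "P a b"
    using ab
  proof (induction rule: Bolzano)
    case (trans u v w)
    show ?case unfolding P_def
    proof
      assume *: "a \<le> u \<and> u \<le> w \<and> w \<le> b"
      obtain F where F: "F \<in> holo_approximable \<Omega> X"
        "\<And>z. z \<in> X \<Longrightarrow> cmod (integral {u..v} (\<lambda>t. G (t, z)) - F z) \<le> \<epsilon> * (v - u)"
        using trans * unfolding P_def by force
      obtain F' where F': "F' \<in> holo_approximable \<Omega> X"
        "\<And>z. z \<in> X \<Longrightarrow> cmod (integral {v..w} (\<lambda>t. G (t, z)) - F' z) \<le> \<epsilon> * (w - v)"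
        using trans * unfolding P_def by force
      have "cmod (integral {u..w} (\<lambda>t. G (t, z)) - (F z + F' z)) \<le> \<epsilon> * (w - u)" if z: "z \<in> X" for z
      proof -
        have "integral {u..w} (\<lambda>t. G (t, z)) = integral {u..v} (\<lambda>t. G (t, z)) + integral {v..w} (\<lambda>t. G (t, z))"
          using trans * int[OF z] by (intro Henstock_Kurzweil_Integration.integral_combine[symmetric]) auto
        then show ?thesis
          using norm_triangle_ineq[of "integral {u..v} (\<lambda>t. G (t, z)) - F z" "integral {v..w} (\<lambda>t. G (t, z)) - F' z"]
            F(2)[OF z] F'(2)[OF z] by (simp add: algebra_simps)
      qed
      then show "\<exists>F\<in>holo_approximable \<Omega> X. \<forall>z\<in>X. cmod (integral {u..w} (\<lambda>t. G (t, z)) - F z) \<le> \<epsilon> * (w - u)"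
        by (intro bexI[OF _ holo_approximable_add[OF F(1) F'(1)]]) auto
    qed
  next
    case (local x)
    have "P u v" if uv: "u \<le> x \<and> x \<le> v \<and> v - u < d" for u v
      unfolding P_def
    proof
      assume *: "a \<le> u \<and> u \<le> v \<and> v \<le> b"
      have F: "(\<lambda>z. (of_real (v - u) * c x) * (1 / (\<gamma> x - z))) \<in> holo_approximable \<Omega> X"
        using local by (intro holo_approximable_mult[OF X holo_approximable_superset pole]) auto
      moreover have "cmod (integral {u..v} (\<lambda>t. G (t, z)) - (of_real (v - u) * c x) * (1 / (\<gamma> x - z)))
          \<le> \<epsilon> * (v - u)" if z: "z \<in> X" for z
      proof -
        have "((\<lambda>t. G (x, z)) has_integral (v - u) *\<^sub>R G (x, z)) {u..v}"
          using * has_integral_const_real[of "G (x, z)" u v] by simp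
        hence "((\<lambda>t. G (t, z) - G (x, z)) has_integral
            (integral {u..v} (\<lambda>t. G (t, z)) - (v - u) *\<^sub>R G (x, z))) {u..v}"
          using int[OF z, of u v] * by (intro has_integral_diff integrable_integral) auto
        moreover have "norm (G (t, z) - G (x, z)) \<le> \<epsilon>" if "t \<in> {u..v}" for t
        proof -
          have "dist (t, z) (x, z) < d"
            using that uv by (auto simp: dist_Pair_Pair dist_real_def)
          then show ?thesis
            using d(2)[of "(x, z)" "(t, z)"] that z local * by (auto simp: dist_norm less_imp_le)
        qed
        ultimately have "norm (integral {u..v} (\<lambda>t. G (t, z)) - (v - u) *\<^sub>R G (x, z)) \<le> \<epsilon> * (v - u)"
          using has_integral_bound[of \<epsilon> "\<lambda>t. G (t, z) - G (x, z)"
              "integral {u..v} (\<lambda>t. G (t, z)) - (v - u) *\<^sub>R G (x, z)" u v] \<epsilon> *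
          by (simp add: cbox_interval)
        then show ?thesis by (simp add: G_def scaleR_conv_of_real)
      qed
      ultimately show "\<exists>F\<in>holo_approximable \<Omega> X. \<forall>z\<in>X.
          cmod (integral {u..v} (\<lambda>t. G (t, z)) - F z) \<le> \<epsilon> * (v - u)"
        by (intro bexI[OF _ F]) auto
    qed
    with d(1) show ?case by blast
  qed
  then obtain F where F: "F \<in> holo_approximable \<Omega> X"
    "\<forall>z\<in>X. cmod (integral {a..b} (\<lambda>t. G (t, z)) - F z) \<le> \<epsilon> * (b - a)"
    using ab unfolding P_def by blast
  have "\<epsilon> * (b - a) < e"
    using e ab by (simp add: \<epsilon>_def divide_simps)
  with F show "\<exists>F\<in>holo_approximable \<Omega> X. \<forall>z\<in>X. cmod (integral {a..b} (\<lambda>t. c t / (\<gamma> t - z)) - F z) < e"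
    by (force simp: G_def)
qed

section \<open>Runge compact sets and pole pushing\<close>

text \<open>Points of the complement of \<open>X\<close> can escape from \<open>\<Omega>\<close> or to infinity without crossing \<open>X\<close>. Placing the
quantifier over \<open>B\<close> outside the choice of \<open>b\<close> treats the two kinds of escape alike: a single \<open>b\<close>
outside \<open>\<Omega>\<close> serves every bound, an unbounded component supplies a new \<open>b\<close> for each one.\<close>

definition runge_compact :: "complex set \<Rightarrow> complex set \<Rightarrow> bool" where
  "runge_compact \<Omega> X \<longleftrightarrow> compact X \<and> X \<subseteq> \<Omega> \<and>
     (\<forall>\<zeta>\<in>-X. \<forall>B. \<exists>b. connected_component (-X) \<zeta> b \<and> (b \<notin> \<Omega> \<or> cmod b > B))"

text \<open>With \<open>q = (\<zeta> - \<zeta>') / (\<zeta> - z)\<close> one has \<open>1 / (\<zeta>' - z) = (1 / (\<zeta> - z)) \<cdot> (1 / (1 - q))\<close>, and \<open>\<bar>q\<bar> \<le> 1/2\<close> on \<open>X\<close>.\<close>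

lemma nearby_pole_approximable:
  assumes X: "compact X" "X \<subseteq> \<Omega>" and d: "d > 0" "\<And>z. z \<in> X \<Longrightarrow> d \<le> cmod (z - \<zeta>)"
    and near: "cmod (\<zeta>' - \<zeta>) \<le> d / 2"
    and pole: "(\<lambda>z. 1 / (\<zeta> - z)) \<in> holo_approximable \<Omega> X"
  shows "(\<lambda>z. 1 / (\<zeta>' - z)) \<in> holo_approximable \<Omega> X"
proof -
  define q where "q = (\<lambda>z. (\<zeta> - \<zeta>') * (1 / (\<zeta> - z)))"
  have q: "q \<in> holo_approximable \<Omega> X"
    unfolding q_def by (intro holo_approximable_mult[OF X holo_approximable_superset pole]) auto
  have small: "cmod (q z) \<le> 1/2" if z: "z \<in> X" for z
  proof -
    have "cmod (q z) = cmod (\<zeta>' - \<zeta>) / cmod (z - \<zeta>)"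
      by (simp add: q_def norm_divide norm_mult norm_minus_commute)
    also have "\<dots> \<le> (d / 2) / d"
      using near d z by (intro frac_le) auto
    finally show ?thesis using d(1) by simp
  qed
  have "(\<lambda>z. (1 / (\<zeta> - z)) * (1 / (1 - q z))) \<in> holo_approximable \<Omega> X"
    using holo_approximable_mult[OF X pole holo_approximable_geometric[OF X q small]] .
  then show ?thesis
  proof (rule holo_approximable_cong)
    fix z assume z: "z \<in> X"
    have ne: "\<zeta> - z \<noteq> 0" using d(1) d(2)[OF z] by auto
    have "(\<zeta> - z) * (1 - q z) = \<zeta>' - z"
      using ne by (simp add: q_def algebra_simps) (simp add: field_simps)
    then show "(1 / (\<zeta> - z)) * (1 / (1 - q z)) = 1 / (\<zeta>' - z)"
      by (simp only: times_divide_times_eq mult_1_left)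
  qed
qed

text \<open>Here \<open>1 / (b - z) = (1 / b) \<cdot> (1 / (1 - z / b))\<close>, a series of polynomials.\<close>

lemma far_pole_approximable:
  assumes X: "compact X" "X \<subseteq> \<Omega>" and R: "R > 0" "\<And>z. z \<in> X \<Longrightarrow> cmod z \<le> R" and b: "cmod b \<ge> 2 * R"
  shows "(\<lambda>z. 1 / (b - z)) \<in> holo_approximable \<Omega> X"
proof -
  have b0: "b \<noteq> 0" using R b by auto
  define q where "q = (\<lambda>z. z / b)"
  have q: "q \<in> holo_approximable \<Omega> X"
    unfolding q_def using b0 by (intro holo_approximable_superset holomorphic_intros) auto
  have small: "cmod (q z) \<le> 1/2" if z: "z \<in> X" for z
  proof -
    have "cmod z / cmod b \<le> R / (2 * R)"
      using R b z by (intro frac_le) auto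
    then show ?thesis using R(1) by (simp add: q_def norm_divide)
  qed
  have "(\<lambda>z. (1 / b) * (1 / (1 - q z))) \<in> holo_approximable \<Omega> X"
    by (intro holo_approximable_mult[OF X holo_approximable_superset] holo_approximable_geometric[OF X q small]) auto
  then show ?thesis
    by (rule holo_approximable_cong) (use b0 in \<open>auto simp: q_def field_simps\<close>)
qed

text \<open>Pole pushing: approximability of \<open>1 / (\<zeta> - z)\<close> is locally constant in \<open>\<zeta>\<close> off \<open>X\<close>, hence constant on
the components of the complement, and it holds outside \<open>\<Omega>\<close> and near infinity.\<close>

lemma runge_compact_pole_approximable:
  assumes run: "runge_compact \<Omega> X" and \<zeta>: "\<zeta> \<notin> X"
  shows "(\<lambda>z. 1 / (\<zeta> - z)) \<in> holo_approximable \<Omega> X"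
proof -
  have X: "compact X" "X \<subseteq> \<Omega>" using run by (auto simp: runge_compact_def)
  obtain R where R: "R > 0" "\<And>z. z \<in> X \<Longrightarrow> cmod z \<le> R"
    using compact_imp_bounded[OF X(1)] by (auto simp: bounded_pos)
  obtain b where b: "connected_component (-X) \<zeta> b" "b \<notin> \<Omega> \<or> cmod b > 2 * R"
    using run \<zeta> unfolding runge_compact_def by blast
  define P where "P = (\<lambda>\<zeta>. (\<lambda>z. 1 / (\<zeta> - z)) \<in> holo_approximable \<Omega> X)"
  have "P b"
    unfolding P_def
  proof (cases "b \<in> \<Omega>")
    case True
    then show "(\<lambda>z. 1 / (b - z)) \<in> holo_approximable \<Omega> X"
      using far_pole_approximable[OF X R] b(2) by simp
  next
    case False
    then show "(\<lambda>z. 1 / (b - z)) \<in> holo_approximable \<Omega> X"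
      by (intro holo_approximable_superset holomorphic_intros) auto
  qed
  moreover have "P \<zeta> \<longleftrightarrow> P b"
  proof (rule connected_equivalence_relation[where R = "\<lambda>x y. P x \<longleftrightarrow> P y" and S = "connected_component_set (-X) \<zeta>"])
    show "connected (connected_component_set (-X) \<zeta>)" by simp
    show "\<zeta> \<in> connected_component_set (-X) \<zeta>" using \<zeta> by simp
    show "b \<in> connected_component_set (-X) \<zeta>" using b by simp
    fix a assume a: "a \<in> connected_component_set (-X) \<zeta>"
    have oX: "open (-X)" using X(1) by (simp add: compact_imp_closed open_Compl)
    hence "open (connected_component_set (-X) \<zeta>)" by (rule open_connected_component)
    then obtain r where r: "r > 0" "ball a r \<subseteq> connected_component_set (-X) \<zeta>"
      using a open_contains_ball by blast
    have rX: "ball a r \<subseteq> -X"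
      using r(2) connected_component_subset[of "-X" \<zeta>] by blast
    have far: "r \<le> cmod (z - a)" if "z \<in> X" for z
      using that rX by (force simp: dist_norm norm_minus_commute)
    \<comment> \<open>a third of the radius leaves \<open>x\<close> at distance at least \<open>2r/3\<close> from \<open>X\<close>, so the pole moves both ways\<close>
    have "P a \<longleftrightarrow> P x" if x: "x \<in> ball a (r/3)" for x
    proof
      have xa: "cmod (x - a) < r / 3" using x by (simp add: dist_norm norm_minus_commute)
      show "P a \<Longrightarrow> P x"
        unfolding P_def
        by (rule nearby_pole_approximable[OF X r(1) far]) (use xa r in auto)
      have "2 * r / 3 \<le> cmod (z - x)" if "z \<in> X" for z
        using far[OF that] xa norm_triangle_ineq[of "z - x" "x - a"] by simp
      then show "P x \<Longrightarrow> P a"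
        unfolding P_def
        by (intro nearby_pole_approximable[OF X, of "2 * r / 3" x a])
          (use xa r in \<open>auto simp: norm_minus_commute\<close>)
    qed
    moreover have "ball a (r/3) \<subseteq> connected_component_set (-X) \<zeta>"
      using r subset_ball[of "r/3" r a] by auto
    ultimately show "\<exists>T. openin (top_of_set (connected_component_set (-X) \<zeta>)) T \<and> a \<in> T \<and> (\<forall>x\<in>T. P a \<longleftrightarrow> P x)"
      using r(1) by (intro exI[of _ "ball a (r/3)"]) (auto intro: open_subset)
  qed auto
  ultimately show ?thesis by (simp add: P_def)
qed

lemma runge_compact_empty: "runge_compact \<Omega> {}"
proof -
  have "\<exists>b. cmod b > B" for B
    using norm_of_real[of "\<bar>B\<bar> + 1", where ?'a = complex] by (intro exI[of _ "of_real (\<bar>B\<bar> + 1)"]) linarith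
  moreover have "connected_component UNIV \<zeta> b" for \<zeta> b :: complex
    unfolding connected_component_def by (rule exI[of _ UNIV]) auto
  ultimately show ?thesis by (simp add: runge_compact_def) blast
qed

text \<open>A closed disc does not separate the plane, and a point that can escape from \<open>X\<close> can escape from \<open>Y\<close>
as well. Janiszewski's theorem combines the two connections, since the empty set \<open>X \<inter> Y\<close> is connected.\<close>

lemma runge_compact_Un_disc:
  assumes X: "runge_compact \<Omega> X" and Y: "Y homeomorphic cball (0::complex) 1"
    and Y\<Omega>: "Y \<subseteq> \<Omega>" and disj: "X \<inter> Y = {}"
  shows "runge_compact \<Omega> (X \<union> Y)"
  unfolding runge_compact_def
proof (intro conjI ballI allI)
  have cX: "compact X" and X\<Omega>: "X \<subseteq> \<Omega>" using X by (auto simp: runge_compact_def)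
  have cY: "compact Y" using Y compact_cball homeomorphic_compactness by blast
  show "compact (X \<union> Y)" using cX cY by (rule compact_Un)
  show "X \<union> Y \<subseteq> \<Omega>" using X\<Omega> Y\<Omega> by blast
  fix \<zeta> B assume \<zeta>: "\<zeta> \<in> - (X \<union> Y)"
  obtain R where R: "\<And>z. z \<in> Y \<Longrightarrow> cmod z \<le> R"
    using compact_imp_bounded[OF cY] by (auto simp: bounded_iff)
  obtain b where b: "connected_component (-X) \<zeta> b" "b \<notin> \<Omega> \<or> cmod b > max B R"
    using X \<zeta> unfolding runge_compact_def by (meson Compl_iff UnCI)
  have "b \<notin> Y" using b(2) R Y\<Omega> by fastforce
  moreover have "connected (-Y)"
    by (rule connected_complement_homeomorphic_convex_compact[OF Y]) auto
  ultimately have "connected_component (-Y) \<zeta> b"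
    using \<zeta> by (auto simp: connected_component_def)
  then have "connected_component (-(X \<union> Y)) \<zeta> b"
    using Janiszewski[OF cX compact_imp_closed[OF cY]] disj b(1) by simp
  then show "\<exists>b. connected_component (-(X \<union> Y)) \<zeta> b \<and> (b \<notin> \<Omega> \<or> cmod b > B)"
    using b(2) by auto
qed

text \<open>Cutting the \<open>d\<close>-balls about all points outside \<open>\<Omega>\<close> from a large closed disc leaves a compact set
whose complement is that union of balls together with the exterior of the disc. From a point of
some ball one walks to its centre, from an exterior point one walks radially to infinity.\<close>

lemma runge_compact_hull:
  assumes "open \<Omega>" "compact K" "K \<subseteq> \<Omega>"
  obtains L where "runge_compact \<Omega> L" "K \<subseteq> L"
proof -
  obtain R where R: "R > 0" "\<And>z. z \<in> K \<Longrightarrow> cmod z \<le> R"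
    using compact_imp_bounded[OF assms(2)] by (auto simp: bounded_pos)
  have "K \<inter> (-\<Omega>) = {}" using assms by blast
  then obtain d where d: "d > 0" "\<And>z b. z \<in> K \<Longrightarrow> b \<notin> \<Omega> \<Longrightarrow> d \<le> dist z b"
    using separate_compact_closed[OF assms(2), of "-\<Omega>"] assms(1) by (auto simp: closed_Compl)
  define L where "L = cball 0 R - (\<Union>b\<in>-\<Omega>. ball b d)"
  have "compact L"
    unfolding L_def by (intro compact_diff) auto
  moreover have "L \<subseteq> \<Omega>" using d(1) by (force simp: L_def)
  moreover have "K \<subseteq> L"
    using R d by (force simp: L_def dist_commute)
  moreover have "\<exists>b. connected_component (-L) \<zeta> b \<and> (b \<notin> \<Omega> \<or> cmod b > B)" if \<zeta>: "\<zeta> \<in> -L" for \<zeta> B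
  proof (cases "cmod \<zeta> \<le> R")
    case True
    then obtain b where b: "b \<notin> \<Omega>" "\<zeta> \<in> ball b d" using \<zeta> by (auto simp: L_def)
    have "connected_component (-L) \<zeta> b"
      unfolding connected_component_def
      by (rule exI[of _ "ball b d"]) (use b d(1) in \<open>auto simp: L_def\<close>)
    with b(1) show ?thesis by blast
  next
    case False
    define b where "b = complex_of_real (1 + \<bar>B\<bar> / R) * \<zeta>"
    have B: "cmod b > B"
    proof -
      have "cmod b = (1 + \<bar>B\<bar> / R) * cmod \<zeta>"
        using R(1) unfolding b_def norm_mult norm_of_real by simp
      also have "\<dots> > (1 + \<bar>B\<bar> / R) * R"
        using False R(1) by (intro mult_strict_left_mono) (auto simp: add_pos_nonneg)
      also have "(1 + \<bar>B\<bar> / R) * R = R + \<bar>B\<bar>" using R(1) by (simp add: field_simps)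
      finally show ?thesis using R(1) by linarith
    qed
    have "connected ((\<lambda>t. complex_of_real t * \<zeta>) ` {1..})"
      by (intro connected_continuous_image continuous_intros) auto
    moreover have "(\<lambda>t. complex_of_real t * \<zeta>) ` {1..} \<subseteq> -L"
    proof clarify
      fix t :: real assume t: "1 \<le> t" "complex_of_real t * \<zeta> \<in> L"
      have "cmod \<zeta> \<le> t * cmod \<zeta>" using t(1) by (simp add: mult_right_mono[of 1 t, simplified] mult_le_cancel_right1)
      also have "\<dots> = cmod (complex_of_real t * \<zeta>)" using t(1) by (simp add: norm_mult)
      also have "\<dots> \<le> R" using t(2) by (simp add: L_def)
      finally show False using False by simp
    qed
    moreover have "\<zeta> \<in> (\<lambda>t. complex_of_real t * \<zeta>) ` {1..}"
      by (rule image_eqI[of _ _ 1]) auto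
    moreover have "b \<in> (\<lambda>t. complex_of_real t * \<zeta>) ` {1..}"
      unfolding b_def using R(1) by (intro imageI) auto
    ultimately have "connected_component (-L) \<zeta> b"
      unfolding connected_component_def by blast
    with B show ?thesis by blast
  qed
  ultimately show ?thesis using that[of L] by (auto simp: runge_compact_def)
qed

section \<open>Approximation on conformal discs\<close>

text \<open>After the substitution \<open>u = \<Psi> w\<close> these are the Cauchy integrals of \<open>p \<circ> \<Psi>\<^sup>-\<^sup>1\<close> over the curve
\<open>\<Psi>(\<bar>w\<bar> = \<rho>)\<close>, and Cauchy's theorem can be applied in the round disc. At \<open>z = \<Psi> w0\<close> the integrand
is \<open>G w / (w - w0)\<close>, where \<open>G\<close> is holomorphic with \<open>G w0 = p w0\<close> because \<open>\<Psi>\<close> is injective; at \<open>z\<close> off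
the image the integrand is holomorphic in the whole disc.\<close>

lemma
  assumes s: "s > 1" and \<rho>: "1 < \<rho>" "\<rho> < s"
    and hol: "\<Psi> holomorphic_on ball 0 s" and inj: "inj_on \<Psi> (ball 0 s)"
    and p: "p holomorphic_on ball 0 s"
  shows cell_integral_inside: "cmod w0 \<le> 1 \<Longrightarrow>
          contour_integral (circlepath 0 \<rho>) (\<lambda>w. p w * deriv \<Psi> w / (\<Psi> w - \<Psi> w0)) = 2 * of_real pi * \<i> * p w0"
    and cell_integral_outside: "z \<notin> \<Psi> ` ball 0 s \<Longrightarrow>
          contour_integral (circlepath 0 \<rho>) (\<lambda>w. p w * deriv \<Psi> w / (\<Psi> w - z)) = 0"
proof -
  have d: "deriv \<Psi> holomorphic_on ball 0 s" using hol by (rule holomorphic_deriv) simp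
  show "contour_integral (circlepath 0 \<rho>) (\<lambda>w. p w * deriv \<Psi> w / (\<Psi> w - \<Psi> w0)) = 2 * of_real pi * \<i> * p w0"
    if w0: "cmod w0 \<le> 1"
  proof -
    have w0s: "w0 \<in> ball 0 s" using w0 s by auto
    \<comment> \<open>the removable singularity of the difference quotient is filled by the derivative\<close>
    define Q where "Q = (\<lambda>w. if w = w0 then deriv \<Psi> w0 else (\<Psi> w - \<Psi> w0) / (w - w0))"
    have Q: "Q holomorphic_on ball 0 s"
      unfolding Q_def by (rule pole_lemma[OF hol]) (use w0s in simp)
    have dne: "deriv \<Psi> w0 \<noteq> 0"
      using holomorphic_injective_imp_regular[OF hol open_ball inj w0s] .
    have Qne: "Q w \<noteq> 0" if "w \<in> ball 0 s" for w
      using dne inj_onD[OF inj, of w w0] that w0s by (auto simp: Q_def)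
    define G where "G = (\<lambda>w. p w * deriv \<Psi> w / Q w)"
    have G: "G holomorphic_on ball 0 s"
      unfolding G_def using Qne by (intro holomorphic_on_divide holomorphic_on_mult p d Q)
    have sub: "cball 0 \<rho> \<subseteq> ball (0::complex) s" using \<rho> by auto
    have "((\<lambda>u. G u / (u - w0)) has_contour_integral (2 * of_real pi * \<i> * G w0)) (circlepath 0 \<rho>)"
    proof (rule Cauchy_integral_circlepath)
      show "continuous_on (cball 0 \<rho>) G"
        using holomorphic_on_subset[OF G sub] holomorphic_on_imp_continuous_on by blast
      show "G holomorphic_on ball 0 \<rho>"
        using holomorphic_on_subset[OF G] sub ball_subset_cball by blast
    qed (use w0 \<rho> in simp)
    then have "((\<lambda>w. p w * deriv \<Psi> w / (\<Psi> w - \<Psi> w0)) has_contour_integral (2 * of_real pi * \<i> * G w0)) (circlepath 0 \<rho>)"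
    proof (rule has_contour_integral_eq)
      fix u assume "u \<in> path_image (circlepath 0 \<rho>)"
      then have "cmod u = \<rho>" using \<rho> by (simp add: path_image_circlepath)
      then have "u \<noteq> w0" using w0 \<rho> by auto
      then show "G u / (u - w0) = p u * deriv \<Psi> u / (\<Psi> u - \<Psi> w0)" by (simp add: G_def Q_def)
    qed
    moreover have "G w0 = p w0" using dne by (simp add: G_def Q_def)
    ultimately have "((\<lambda>w. p w * deriv \<Psi> w / (\<Psi> w - \<Psi> w0)) has_contour_integral (2 * of_real pi * \<i> * p w0)) (circlepath 0 \<rho>)"
      by simp
    then show ?thesis by (rule contour_integral_unique)
  qed
  show "contour_integral (circlepath 0 \<rho>) (\<lambda>w. p w * deriv \<Psi> w / (\<Psi> w - z)) = 0"
    if z: "z \<notin> \<Psi> ` ball 0 s"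
  proof -
    have "(\<lambda>w. p w * deriv \<Psi> w / (\<Psi> w - z)) holomorphic_on ball 0 s"
      using z by (intro holomorphic_on_divide holomorphic_on_mult holomorphic_on_diff p d hol) auto
    then have "((\<lambda>w. p w * deriv \<Psi> w / (\<Psi> w - z)) has_contour_integral 0) (circlepath 0 \<rho>)"
      by (rule Cauchy_theorem_convex_simple) (use \<rho> in \<open>auto simp: path_image_circlepath\<close>)
    then show ?thesis by (rule contour_integral_unique)
  qed
qed

text \<open>The Cauchy integral of the preceding lemma is exactly \<open>0\<close> on \<open>X\<close> and \<open>p\<close> on the disc. Its poles lie
on the curve of radius \<open>\<rho>\<close>, which misses both sets, so it is a uniform limit of functions holomorphic on \<open>\<Omega>\<close>.\<close>

lemma one_cell_approximation:
  assumes run: "runge_compact \<Omega> (X \<union> \<Psi> ` cball 0 1)" and s: "s > 1"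
    and hol: "\<Psi> holomorphic_on ball 0 s" and inj: "inj_on \<Psi> (ball 0 s)"
    and disj: "X \<inter> \<Psi> ` ball 0 s = {}"
    and p: "p holomorphic_on ball 0 s" and e: "e > 0"
  obtains h where "h holomorphic_on \<Omega>" "\<And>z. z \<in> X \<Longrightarrow> cmod (h z) < e"
    "\<And>w. w \<in> cball 0 1 \<Longrightarrow> cmod (h (\<Psi> w) - p w) < e"
proof -
  define \<rho> where "\<rho> = (1 + s) / 2"
  have \<rho>: "1 < \<rho>" "\<rho> < s" using s by (auto simp: \<rho>_def)
  define Y where "Y = \<Psi> ` cball 0 1"
  have XY: "compact (X \<union> Y)" "X \<union> Y \<subseteq> \<Omega>" using run by (auto simp: runge_compact_def Y_def)
  define C where "C = circlepath (0::complex) \<rho>"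
  have Cn: "cmod (C t) = \<rho>" for t
    using \<rho> by (simp add: C_def circlepath norm_mult)
  have Cball: "C t \<in> ball 0 s" for t using Cn[of t] \<rho> by simp
  have contC: "continuous_on {0..1} C"
    unfolding C_def circlepath by (intro continuous_intros)
  define \<gamma> where "\<gamma> = (\<lambda>t. \<Psi> (C t))"
  define c where "c = (\<lambda>t. p (C t) * deriv \<Psi> (C t) * vector_derivative C (at t))"
  have d: "deriv \<Psi> holomorphic_on ball 0 s" using hol by (rule holomorphic_deriv) simp
  have compC: "continuous_on {0..1} (\<lambda>t. F (C t))" if "F holomorphic_on ball 0 s" for F
    by (rule continuous_on_compose2[OF holomorphic_on_imp_continuous_on[OF that] contC])
      (use Cball in auto)
  have cont: "continuous_on {0..1} c" "continuous_on {0..1} \<gamma>"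
    unfolding c_def \<gamma>_def
    using compC[OF hol] compC[OF p] compC[OF d]
    by (auto simp: C_def vector_derivative_circlepath intro!: continuous_intros)
  have off: "\<gamma> t \<notin> X \<union> Y" for t
  proof -
    have "\<gamma> t \<notin> X" using disj Cball by (auto simp: \<gamma>_def)
    moreover have "\<gamma> t \<notin> Y"
    proof
      assume "\<gamma> t \<in> Y"
      then obtain w where w: "w \<in> cball 0 1" "\<Psi> (C t) = \<Psi> w" by (auto simp: Y_def \<gamma>_def)
      then have "C t = w" using inj_onD[OF inj, of "C t" w] Cball[of t] s by auto
      then show False using Cn[of t] \<rho> w(1) by simp
    qed
    ultimately show ?thesis by blast
  qed
  define J where "J = (\<lambda>z. integral {0..1} (\<lambda>t. c t / (\<gamma> t - z)))"
  have J_eq: "J z = contour_integral C (\<lambda>w. p w * deriv \<Psi> w / (\<Psi> w - z))" for z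
    by (simp add: J_def contour_integral_integral c_def \<gamma>_def)
  have "J \<in> holo_approximable \<Omega> (X \<union> Y)"
    unfolding J_def
    by (rule holo_approximable_integral[OF XY cont]) (use off runge_compact_pole_approximable[OF run] in \<open>auto simp: Y_def\<close>)
  then have "(\<lambda>z. (1 / (2 * of_real pi * \<i>)) * J z) \<in> holo_approximable \<Omega> (X \<union> Y)"
    by (intro holo_approximable_mult[OF XY holo_approximable_superset]) auto
  then obtain h where h: "h holomorphic_on \<Omega>"
    "\<And>z. z \<in> X \<union> Y \<Longrightarrow> cmod ((1 / (2 * of_real pi * \<i>)) * J z - h z) < e"
    using e by (rule holo_approximableD) blast
  have "cmod (h z) < e" if z: "z \<in> X" for z
  proof -
    have "z \<notin> \<Psi> ` ball 0 s" using disj z by blast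
    then have "J z = 0"
      unfolding J_eq C_def by (rule cell_integral_outside[OF s \<rho> hol inj p])
    then show ?thesis using h(2)[of z] z by simp
  qed
  moreover have "cmod (h (\<Psi> w) - p w) < e" if w: "w \<in> cball 0 1" for w
  proof -
    have "J (\<Psi> w) = 2 * of_real pi * \<i> * p w"
      unfolding J_eq C_def by (rule cell_integral_inside[OF s \<rho> hol inj p]) (use w in simp)
    then show ?thesis using h(2)[of "\<Psi> w"] w by (simp add: Y_def norm_minus_commute)
  qed
  ultimately show ?thesis using that h(1) by blast
qed

lemma holomorphic_injective_disc_homeomorphic:
  assumes "s > 1" "\<Psi> holomorphic_on ball 0 s" "inj_on \<Psi> (ball 0 s)"
  shows "\<Psi> ` cball 0 1 homeomorphic cball (0::complex) 1"
proof -
  have "cball 0 1 \<subseteq> ball (0::complex) s" using assms(1) by auto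
  then have "continuous_on (cball 0 1) \<Psi>" "inj_on \<Psi> (cball 0 1)"
    using assms by (auto intro: inj_on_subset holomorphic_on_imp_continuous_on continuous_on_subset)
  then show ?thesis
    by (subst homeomorphic_sym, intro homeomorphic_compact[of _ \<Psi>]) auto
qed

text \<open>The discs are added one at a time. A correction that is small on the part already treated repairs
the values on the new disc, and the new union is again a Runge compact set.\<close>

lemma finite_cells_approximation:
  fixes \<Psi> :: "'i \<Rightarrow> complex \<Rightarrow> complex" and s :: "'i \<Rightarrow> real"
  assumes "finite J" and K: "runge_compact \<Omega> K"
    and cell: "\<And>j. j \<in> J \<Longrightarrow> s j > 1" "\<And>j. j \<in> J \<Longrightarrow> \<Psi> j holomorphic_on ball 0 (s j)"
      "\<And>j. j \<in> J \<Longrightarrow> inj_on (\<Psi> j) (ball 0 (s j))" "\<And>j. j \<in> J \<Longrightarrow> \<Psi> j ` ball 0 (s j) \<subseteq> \<Omega>"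
      "\<And>j. j \<in> J \<Longrightarrow> K \<inter> \<Psi> j ` ball 0 (s j) = {}"
    and disj: "disjoint_family_on (\<lambda>j. \<Psi> j ` ball 0 (s j)) J"
    and p: "\<And>j. j \<in> J \<Longrightarrow> p j holomorphic_on ball 0 (s j)"
    and g: "g holomorphic_on \<Omega>" and e: "e > 0"
  shows "runge_compact \<Omega> (K \<union> (\<Union>j\<in>J. \<Psi> j ` cball 0 1)) \<and>
     (\<exists>h. h holomorphic_on \<Omega> \<and> (\<forall>z\<in>K. cmod (h z - g z) < e) \<and>
        (\<forall>j\<in>J. \<forall>w\<in>cball 0 1. cmod (h (\<Psi> j w) - p j w) < e))"
  using assms(1) cell disj p e
proof (induction J arbitrary: e rule: finite_induct)
  case empty
  then show ?case using K g by (auto intro!: exI[of _ g])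
next
  case (insert i J)
  note cell = insert.prems(1-5) and disj = insert.prems(6) and p = insert.prems(7) and e = insert.prems(8)
  define X where "X = K \<union> (\<Union>j\<in>J. \<Psi> j ` cball 0 1)"
  have e2: "e / 2 > 0" using e by simp
  have disjJ: "disjoint_family_on (\<lambda>j. \<Psi> j ` ball 0 (s j)) J"
    using disj by (rule disjoint_family_on_mono[rotated]) auto
  have IH: "runge_compact \<Omega> X \<and> (\<exists>h. h holomorphic_on \<Omega> \<and> (\<forall>z\<in>K. cmod (h z - g z) < e / 2) \<and>
        (\<forall>j\<in>J. \<forall>w\<in>cball 0 1. cmod (h (\<Psi> j w) - p j w) < e / 2))"
    unfolding X_def by (rule insert.IH) (use cell p e2 disjJ in simp_all)
  then obtain h where h: "h holomorphic_on \<Omega>" "\<And>z. z \<in> K \<Longrightarrow> cmod (h z - g z) < e / 2"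
     "\<And>j w. j \<in> J \<Longrightarrow> w \<in> cball 0 1 \<Longrightarrow> cmod (h (\<Psi> j w) - p j w) < e / 2" by blast
  note ci = cell[of i, OF insertI1]
  have sub: "\<Psi> j ` cball 0 1 \<subseteq> \<Psi> j ` ball 0 (s j)" if "j \<in> insert i J" for j
    using cell(1)[OF that] by auto
  have XY: "X \<inter> \<Psi> i ` ball 0 (s i) = {}"
  proof -
    have "\<Psi> j ` ball 0 (s j) \<inter> \<Psi> i ` ball 0 (s i) = {}" if "j \<in> J" for j
      using disj that insert.hyps(2) unfolding disjoint_family_on_def by (metis insertI1 insertI2)
    then show ?thesis using sub ci(5) unfolding X_def by blast
  qed
  have run: "runge_compact \<Omega> (X \<union> \<Psi> i ` cball 0 1)"
    by (rule runge_compact_Un_disc[OF conjunct1[OF IH] holomorphic_injective_disc_homeomorphic[OF ci(1,2,3)]])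
      (use sub[of i] ci(4) XY in auto)
  have pi: "(\<lambda>w. p i w - h (\<Psi> i w)) holomorphic_on ball 0 (s i)"
    using p ci h(1) by (intro holomorphic_on_diff holomorphic_on_compose_gen[of "\<Psi> i" _ h \<Omega>, unfolded o_def]) auto
  obtain k where k: "k holomorphic_on \<Omega>" "\<And>z. z \<in> X \<Longrightarrow> cmod (k z) < e / 2"
    "\<And>w. w \<in> cball 0 1 \<Longrightarrow> cmod (k (\<Psi> i w) - (p i w - h (\<Psi> i w))) < e / 2"
    using one_cell_approximation[OF run ci(1,2,3) XY pi e2] by blast
  define H where "H = (\<lambda>z. h z + k z)"
  have "H holomorphic_on \<Omega>" unfolding H_def using h(1) k(1) by (rule holomorphic_on_add)
  moreover have "cmod (H z - g z) < e" if "z \<in> K" for z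
    using norm_triangle_ineq[of "h z - g z" "k z"] h(2)[OF that] k(2)[of z] that
    by (simp add: H_def X_def algebra_simps)
  moreover have "cmod (H (\<Psi> j w) - p j w) < e" if "j \<in> insert i J" "w \<in> cball 0 1" for j w
  proof (cases "j = i")
    case True
    then show ?thesis using k(3)[OF that(2)] e by (simp add: H_def algebra_simps)
  next
    case False
    then have j: "j \<in> J" using that by simp
    then have "\<Psi> j w \<in> X" using that(2) unfolding X_def by blast
    then show ?thesis
      using norm_triangle_ineq[of "h (\<Psi> j w) - p j w" "k (\<Psi> j w)"] h(3)[OF j that(2)] k(2)[of "\<Psi> j w"]
      by (simp add: H_def algebra_simps)
  qed
  ultimately have ex: "\<exists>h. h holomorphic_on \<Omega> \<and> (\<forall>z\<in>K. cmod (h z - g z) < e) \<and>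
        (\<forall>j\<in>insert i J. \<forall>w\<in>cball 0 1. cmod (h (\<Psi> j w) - p j w) < e)" by (intro exI[of _ H]) simp
  have "X \<union> \<Psi> i ` cball 0 1 = K \<union> (\<Union>j\<in>insert i J. \<Psi> j ` cball 0 1)"
    by (auto simp: X_def)
  with run have "runge_compact \<Omega> (K \<union> (\<Union>j\<in>insert i J. \<Psi> j ` cball 0 1))" by (simp only:)
  then show ?case using ex by (rule conjI)
qed

section \<open>The extended plane and escape to the boundary\<close>

lemma continuous_on_stereo: "continuous_on S stereo"
  unfolding continuous_on_iff by (auto simp: dist_ecomplex_def)

lemma dist_Fin_le: "dist (Fin z) (Fin w) \<le> 2 * dist z w"
proof -
  have "1 \<le> sqrt (1 + (cmod z)\<^sup>2) * sqrt (1 + (cmod w)\<^sup>2)"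
    using mult_mono[of 1 "sqrt (1 + (cmod z)\<^sup>2)" 1 "sqrt (1 + (cmod w)\<^sup>2)"] by simp
  then have "2 * cmod (z - w) / (sqrt (1 + (cmod z)\<^sup>2) * sqrt (1 + (cmod w)\<^sup>2)) \<le> 2 * cmod (z - w) / 1"
    by (intro divide_left_mono) auto
  then show ?thesis by (simp add: dist_Fin_Fin dist_norm)
qed

lemma continuous_on_Fin: "continuous_on S Fin"
  unfolding continuous_on_iff
proof (intro ballI allI impI)
  fix x e assume "x \<in> S" and e: "(e::real) > 0"
  have "dist (Fin x') (Fin x) < e" if "dist x' x < e / 2" for x'
    using dist_Fin_le[of x' x] that by linarith
  then show "\<exists>d>0. \<forall>x'\<in>S. dist x' x < d \<longrightarrow> dist (Fin x') (Fin x) < e"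
    using e by (intro exI[of _ "e / 2"]) auto
qed

text \<open>Stereographic projection \<open>(x, t) \<mapsto> x / (1 - t)\<close> inverts \<open>stereo \<circ> Fin\<close> and is continuous away from the
north pole, so the image of \<open>T\<close> is the preimage of an open set.\<close>

lemma open_Fin_image:
  assumes "open T"
  shows "open (Fin ` T)"
proof -
  define S where "S = {p :: complex \<times> real. snd p \<noteq> 1}"
  define \<pi> where "\<pi> = (\<lambda>p. fst p / complex_of_real (1 - snd p))"
  have oS: "open S"
    unfolding S_def by (intro open_Collect_neq continuous_intros)
  have "continuous_on S \<pi>"
    unfolding \<pi>_def by (intro continuous_intros) (auto simp: S_def)
  then have "open (S \<inter> \<pi> -` T)"
    using assms oS continuous_on_open_vimage by (metis Int_commute)
  then have "open (stereo -` (S \<inter> \<pi> -` T))"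
    using continuous_on_stereo by (rule open_vimage)
  moreover have "stereo -` (S \<inter> \<pi> -` T) = Fin ` T"
  proof -
    have 1: "stereo (Fin z) \<in> S" for z
      using stereo_snd_ne_1[of z] by (simp add: S_def)
    have 2: "\<pi> (stereo (Fin z)) = z" for z
    proof -
      define s where "s = 1 + (cmod z)\<^sup>2"
      have s: "s > 0" using one_plus_sq_pos[of z] by (simp add: s_def)
      have "1 - ((cmod z)\<^sup>2 - 1) / (1 + (cmod z)\<^sup>2) = 2 / s"
        using s by (simp add: s_def field_simps)
      then have "\<pi> (stereo (Fin z)) = complex_of_real (2 / s) * z / complex_of_real (2 / s)"
        by (simp only: \<pi>_def stereo.simps fst_conv snd_conv flip: s_def)
      moreover have "complex_of_real (2 / s) \<noteq> 0" using s by (simp only: of_real_eq_0_iff) simp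
      ultimately show ?thesis by (simp only: nonzero_mult_div_cancel_left not_False_eq_True)
    qed
    have 3: "stereo Infty \<notin> S" by (simp add: S_def)
    show ?thesis
    proof (intro set_eqI)
      fix p
      show "p \<in> stereo -` (S \<inter> \<pi> -` T) \<longleftrightarrow> p \<in> Fin ` T"
      proof (cases p)
        case (Fin z)
        then show ?thesis using 1[of z] 2[of z] by auto
      next
        case Infty
        then show ?thesis using 3 by auto
      qed
    qed
  qed
  ultimately show ?thesis by simp
qed

lemma connected_UNIV_ecomplex: "connected (UNIV :: ecomplex set)"
proof -
  have "connected (range Fin)"
    by (intro connected_continuous_image continuous_on_Fin connected_UNIV)
  then have "connected (closure (range Fin))" by (rule connected_imp_connected_closure)
  moreover have "Infty \<in> closure (range Fin)"
    unfolding closure_approachable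
  proof (intro allI impI)
    fix e :: real assume e: "e > 0"
    define z where "z = complex_of_real (2 / e)"
    have "2 / e < sqrt (1 + (2 / e)\<^sup>2)"
      using e by (intro real_less_rsqrt) auto
    moreover have "cmod z = 2 / e" using e by (simp add: z_def norm_divide)
    ultimately have "e * (2 / e) < e * sqrt (1 + (cmod z)\<^sup>2)"
      using e by (intro mult_strict_left_mono) (simp_all only:)
    then have "2 < e * sqrt (1 + (cmod z)\<^sup>2)" using e by simp
    moreover have "0 < sqrt (1 + (cmod z)\<^sup>2)" using one_plus_sq_pos[of z] by simp
    ultimately have "2 / sqrt (1 + (cmod z)\<^sup>2) < e"
      by (simp add: divide_less_eq)
    then show "\<exists>y\<in>range Fin. dist y Infty < e"
      by (metis dist_Fin_Infty rangeI)
  qed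
  moreover have "p \<in> closure (range Fin)" if "p \<noteq> Infty" for p
    using that closure_subset[of "range Fin"] by (cases p) auto
  ultimately show ?thesis by (metis UNIV_eq_I)
qed

text \<open>Otherwise \<open>Fin ` \<Omega>\<close> would be clopen in the connected extended plane, although it omits \<open>Infty\<close>.
Without this fact the convention \<open>infdist x {} = 0\<close> would make the convergence to the boundary hold vacuously.\<close>

lemma boundary_inf_nonempty:
  assumes "open \<Omega>" "\<Omega> \<noteq> {}"
  shows "boundary_inf \<Omega> \<noteq> {}"
proof
  assume "boundary_inf \<Omega> = {}"
  then have "closure (Fin ` \<Omega>) = Fin ` \<Omega>"
    using open_Fin_image[OF assms(1)] closure_subset[of "Fin ` \<Omega>"]
    by (auto simp: boundary_inf_def frontier_def interior_open)
  then have "closed (Fin ` \<Omega>)" by (metis closed_closure)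
  then have "Fin ` \<Omega> = {} \<or> Fin ` \<Omega> = UNIV"
    using open_Fin_image[OF assms(1)] connected_UNIV_ecomplex connected_clopen[of "UNIV :: ecomplex set"]
    by (metis closed_closedin open_openin subtopology_UNIV)
  then show False using assms(2) by (auto dest: arg_cong[where f = "\<lambda>S. Infty \<in> S"])
qed

lemma compact_away_from_boundary_inf:
  assumes "open \<Omega>" "compact L" "L \<subseteq> \<Omega>"
  obtains d where "d > 0" "\<And>z. z \<in> L \<Longrightarrow> d \<le> infdist (Fin z) (boundary_inf \<Omega>)"
proof (cases "L = {}")
  case True
  then show ?thesis using that[of 1] by simp
next
  case False
  have "continuous_on L (\<lambda>z. infdist (Fin z) (boundary_inf \<Omega>))"
    by (intro continuous_on_infdist continuous_on_Fin)
  from continuous_attains_inf[OF assms(2) False this]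
  obtain w where w: "w \<in> L" "\<And>z. z \<in> L \<Longrightarrow> infdist (Fin w) (boundary_inf \<Omega>) \<le> infdist (Fin z) (boundary_inf \<Omega>)"
    by blast
  have "Fin w \<notin> boundary_inf \<Omega>"
    using w(1) assms(3) open_Fin_image[OF assms(1)]
    by (auto simp: boundary_inf_def frontier_def interior_open)
  then have "infdist (Fin w) (boundary_inf \<Omega>) > 0"
    using boundary_inf_nonempty[OF assms(1)] w(1) assms(3)
    by (intro infdist_pos_not_in_closed) (auto simp: boundary_inf_def)
  then show ?thesis using that w(2) by blast
qed

lemma locally_uniform_limit_compact:
  assumes lim: "locally_uniform_limit U F l" and M: "compact M" "M \<subseteq> U"
  shows "uniform_limit M F l sequentially"
proof -
  obtain V where V: "\<And>z. z \<in> M \<Longrightarrow> open (V z) \<and> z \<in> V z \<and> uniform_limit (V z) F l sequentially"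
    using lim M(2) unfolding locally_uniform_limit_def by (metis subsetD)
  obtain N where N: "N \<subseteq> M" "finite N" "M \<subseteq> (\<Union>z\<in>N. V z)"
    using compactE_image[OF M(1), of M V] V by blast
  show ?thesis
    unfolding uniform_limit_iff
  proof (intro allI impI)
    fix e :: real assume "e > 0"
    then have "\<forall>\<^sub>F n in sequentially. \<forall>z\<in>N. \<forall>x\<in>V z. dist (F n x) (l x) < e"
      using V N(1) by (intro eventually_ball_finite N(2)) (auto simp: uniform_limit_iff)
    then show "\<forall>\<^sub>F n in sequentially. \<forall>x\<in>M. dist (F n x) (l x) < e"
      by eventually_elim (use N(3) in blast)
  qed
qed

lemma iterates_leave_compact:
  assumes "open \<Omega>" "compact L" "L \<subseteq> \<Omega>"
    and lim: "locally_uniform_limit U (\<lambda>n z. infdist (Fin ((f ^^ n) z)) (boundary_inf \<Omega>)) (\<lambda>_. 0)"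
    and M: "compact M" "M \<subseteq> U"
  shows "\<forall>\<^sub>F n in sequentially. (f ^^ n) ` M \<inter> L = {}"
proof -
  obtain d where d: "d > 0" "\<And>z. z \<in> L \<Longrightarrow> d \<le> infdist (Fin z) (boundary_inf \<Omega>)"
    using compact_away_from_boundary_inf[OF assms(1-3)] by blast
  have "\<forall>\<^sub>F n in sequentially. \<forall>z\<in>M. dist (infdist (Fin ((f ^^ n) z)) (boundary_inf \<Omega>)) 0 < d"
    using locally_uniform_limit_compact[OF lim M] d(1) by (simp add: uniform_limit_iff)
  then show ?thesis
    by eventually_elim (use d(2) in \<open>fastforce simp: infdist_nonneg\<close>)
qed

section \<open>Riemann maps for open sets without holes\<close>

text \<open>Suppose the complement of a component \<open>C\<close> had a bounded component \<open>B\<close>. It contains a point outside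
\<open>U\<close>, since otherwise it would be a union of components of \<open>U\<close> and hence clopen in the plane; and as \<open>U\<close> has no holes this point is joined to \<open>Infty\<close> off \<open>U\<close> in the extended plane. But by
the Sura-Bura theorem \<open>B\<close> lies in a compact set \<open>K\<close> that is relatively open in the complement of \<open>C\<close>,
and \<open>K\<close> separates the two ends of this connection. The theorem is needed because \<open>B\<close> itself
need not be relatively open.\<close>

lemma simply_connected_components_of_no_holes:
  assumes U: "open U" "\<nexists>H. is_hole U H" and C: "C \<in> components U"
  shows "simply_connected C"
proof -
  have oC: "open C" using open_components[OF U(1) C] .
  have cC: "connected C" using in_components_connected[OF C] .
  have CU: "C \<subseteq> U" using in_components_subset[OF C] .
  have "\<not> bounded B" if B: "B \<in> components (-C)" for B
  proof
    assume "bounded B"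
    have clC: "closed (-C)" using oC by (simp add: closed_Compl)
    then have "compact B" using closed_components[OF _ B] \<open>bounded B\<close> by (simp add: compact_eq_bounded_closed)
    then obtain K where K: "openin (top_of_set (-C)) K" "compact K" "B \<subseteq> K"
      using Sura_Bura_clopen_subset[OF closed_imp_locally_compact[OF clC] B, of UNIV] by auto
    obtain T where T: "open T" "K = -C \<inter> T" using K(1) by (auto simp: openin_open)
    have "\<not> B \<subseteq> U"
    proof
      assume BU: "B \<subseteq> U"
      have "open B"
      proof (subst open_subopen, intro ballI)
        fix b assume b: "b \<in> B"
        define C' where "C' = connected_component_set U b"
        have C': "C' \<in> components U" "b \<in> C'" using b BU by (auto simp: C'_def componentsI)
        have "b \<notin> C" using b in_components_subset[OF B] by blast
        then have "C \<inter> C' = {}" using components_nonoverlap[OF C C'(1)] C'(2) by blast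
        then have "C' \<subseteq> B"
          using components_maximal[OF B in_components_connected[OF C'(1)]] b C'(2) by blast
        then show "\<exists>T. open T \<and> b \<in> T \<and> T \<subseteq> B"
          using open_components[OF U(1) C'(1)] C'(2) by blast
      qed
      then have "B = {} \<or> B = UNIV"
        using closed_components[OF clC B] clopen[of B] by blast
      then show False
        using in_components_nonempty[OF B] \<open>bounded B\<close> not_bounded_UNIV by metis
    qed
    then obtain p where p: "p \<in> B" "p \<notin> U" by blast
    define H where "H = connected_component_set (UNIV - Fin ` U) (Fin p)"
    have pH: "Fin p \<in> H" using p(2) by (auto simp: H_def)
    have "H \<in> components (UNIV - Fin ` U)"
      unfolding H_def by (intro componentsI) (use p(2) in auto)
    then have "Infty \<in> H" using U(2) unfolding is_hole_def by blast
    have HU: "H \<subseteq> UNIV - Fin ` U" unfolding H_def by (rule connected_component_subset)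
    have "closed (Fin ` K)"
      by (intro compact_imp_closed compact_continuous_image continuous_on_Fin K(2))
    moreover have "Fin ` T \<inter> - Fin ` K \<inter> H = {}" using T(2) HU CU by auto
    moreover have "H \<subseteq> Fin ` T \<union> - Fin ` K" using T(2) by auto
    moreover have "connected H" by (simp add: H_def)
    ultimately have "Fin ` T \<inter> H = {} \<or> - Fin ` K \<inter> H = {}"
      using connectedD[of H "Fin ` T" "- Fin ` K"] open_Fin_image[OF T(1)] by (simp add: open_Compl)
    moreover have "Fin p \<in> Fin ` T \<inter> H" using p(1) K(3) T(2) pH by blast
    moreover have "Infty \<in> - Fin ` K \<inter> H" using \<open>Infty \<in> H\<close> by auto
    ultimately show False by blast
  qed
  then show ?thesis
    using simply_connected_eq_unbounded_complement_components[OF oC] cC by blast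
qed

text \<open>The Riemann map is rescaled so that the unit disc still covers \<open>L\<close> while a slightly larger disc
stays over a compact part of \<open>C\<close>; the larger disc makes room for the contour. The plane itself has
no Riemann map and is covered by a dilation.\<close>

lemma riemann_cell:
  assumes C: "open C" "simply_connected C" "C \<noteq> {}" and L: "compact L" "L \<subseteq> C"
  obtains s \<Phi> M where "s > 1" "\<Phi> holomorphic_on ball 0 s" "inj_on \<Phi> (ball 0 s)"
    "\<Phi> ` ball 0 s \<subseteq> M" "compact M" "M \<subseteq> C" "L \<subseteq> \<Phi> ` cball 0 1"
proof -
  consider "C = UNIV" | (disc) f g where "f holomorphic_on C" "g holomorphic_on ball 0 1"
    "\<And>z. z \<in> C \<Longrightarrow> f z \<in> ball 0 1 \<and> g (f z) = z" "\<And>z. z \<in> ball 0 1 \<Longrightarrow> g z \<in> C \<and> f (g z) = z"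
    using simply_connected_eq_biholomorphic_to_disc[OF C(1)] C(2,3) by metis
  then show ?thesis
  proof cases
    case 1
    obtain R where R: "R > 0" "\<And>z. z \<in> L \<Longrightarrow> cmod z \<le> R"
      using compact_imp_bounded[OF L(1)] by (auto simp: bounded_pos)
    show ?thesis
    proof (rule that[of 2 "\<lambda>w. complex_of_real R * w" "cball 0 (2 * R)"])
      show "inj_on (\<lambda>w. complex_of_real R * w) (ball 0 2)" using R(1) by (auto simp: inj_on_def)
      show "(\<lambda>w. complex_of_real R * w) ` ball 0 2 \<subseteq> cball 0 (2 * R)"
        using R(1) by (auto simp: norm_mult)
      show "L \<subseteq> (\<lambda>w. complex_of_real R * w) ` cball 0 1"
      proof
        fix z assume z: "z \<in> L"
        show "z \<in> (\<lambda>w. complex_of_real R * w) ` cball 0 1"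
          using R(1) R(2)[OF z] by (intro image_eqI[of _ _ "z / of_real R"]) (auto simp: norm_divide)
      qed
    qed (use 1 in \<open>auto intro: holomorphic_intros\<close>)
  next
    case disc
    have "compact (insert 0 (f ` L))"
      using disc(1) L by (intro compact_insert compact_continuous_image)
        (auto intro: holomorphic_on_imp_continuous_on holomorphic_on_subset)
    from continuous_attains_sup[OF this insert_not_empty continuous_on_norm_id]
    obtain m where m: "m \<in> insert 0 (f ` L)" "\<And>z. z \<in> insert 0 (f ` L) \<Longrightarrow> cmod z \<le> cmod m"
      by blast
    have m1: "cmod m < 1" using m(1) disc(3) L(2) by auto
    define \<rho> \<sigma> where "\<rho> = (1 + cmod m) / 2" and "\<sigma> = (1 + \<rho>) / 2"
    have \<rho>: "0 < \<rho>" "\<rho> < \<sigma>" "\<sigma> < 1" "cmod m \<le> \<rho>" using m1 by (auto simp: \<rho>_def \<sigma>_def add_pos_nonneg)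
    define \<Phi> where "\<Phi> = (\<lambda>w. g (complex_of_real \<rho> * w))"
    have scale: "cmod (complex_of_real \<rho> * w) < \<sigma>" if "w \<in> ball 0 (\<sigma> / \<rho>)" for w
      using that \<rho> by (simp add: norm_mult field_simps)
    show ?thesis
    proof (rule that[of "\<sigma> / \<rho>" \<Phi> "g ` cball 0 \<sigma>"])
      show "1 < \<sigma> / \<rho>" using \<rho> by simp
      have in1: "complex_of_real \<rho> * w \<in> ball 0 1" if "w \<in> ball 0 (\<sigma> / \<rho>)" for w
        using scale[OF that] \<rho> by simp
      show "\<Phi> holomorphic_on ball 0 (\<sigma> / \<rho>)"
        unfolding \<Phi>_def
        by (rule holomorphic_on_compose_gen[of "\<lambda>w. complex_of_real \<rho> * w" _ g "ball 0 1", unfolded o_def])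
          (use disc(2) in1 in \<open>auto intro: holomorphic_intros\<close>)
      show "inj_on \<Phi> (ball 0 (\<sigma> / \<rho>))"
      proof (rule inj_onI)
        fix w w' assume w: "w \<in> ball 0 (\<sigma> / \<rho>)" "w' \<in> ball 0 (\<sigma> / \<rho>)" "\<Phi> w = \<Phi> w'"
        then have "complex_of_real \<rho> * w = complex_of_real \<rho> * w'"
          using disc(4)[OF in1[OF w(1)]] disc(4)[OF in1[OF w(2)]] unfolding \<Phi>_def by metis
        then show "w = w'" using \<rho>(1) by simp
      qed
      show "\<Phi> ` ball 0 (\<sigma> / \<rho>) \<subseteq> g ` cball 0 \<sigma>"
        using scale by (fastforce simp: \<Phi>_def)
      show "compact (g ` cball 0 \<sigma>)"
        using disc(2) \<rho> by (intro compact_continuous_image holomorphic_on_imp_continuous_on)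
          (auto intro: holomorphic_on_subset)
      show "g ` cball 0 \<sigma> \<subseteq> C" using disc(4) \<rho> by auto
      show "L \<subseteq> \<Phi> ` cball 0 1"
      proof
        fix z assume z: "z \<in> L"
        have "cmod (f z) \<le> \<rho>" using m(2)[of "f z"] z \<rho>(4) by auto
        then show "z \<in> \<Phi> ` cball 0 1"
          using disc(3)[of z] z L(2) \<rho>(1)
          by (intro image_eqI[of _ _ "f z / complex_of_real \<rho>"]) (auto simp: \<Phi>_def norm_divide)
      qed
    qed
  qed
qed

text \<open>The compact set \<open>M\<close> depends only on \<open>U\<close> and \<open>L\<close>. This independence of \<open>P\<close> is what allows the
iterate \<open>P = f^n\<close> to be chosen afterwards, so late that it moves \<open>M\<close> off \<open>K\<close>.\<close>

lemma simultaneous_approximation: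
  assumes U: "open U" "\<And>C. C \<in> components U \<Longrightarrow> simply_connected C" and L: "compact L" "L \<subseteq> U"
  obtains M where "compact M" "M \<subseteq> U"
    "\<And>\<Omega> K P t g e. \<lbrakk>runge_compact \<Omega> K; P holomorphic_on U; inj_on P U; P ` U \<subseteq> \<Omega>; P ` M \<inter> K = {};
        t holomorphic_on U; g holomorphic_on \<Omega>; e > 0\<rbrakk> \<Longrightarrow>
      \<exists>h. h holomorphic_on \<Omega> \<and> (\<forall>z\<in>K. cmod (h z - g z) < e) \<and> (\<forall>z\<in>L. cmod (h (P z) - t z) < e)"
proof -
  obtain J where J: "J \<subseteq> components U" "finite J" "L \<subseteq> \<Union>J"
    using compactE[OF L(1), of "components U"] L(2) open_components[OF U(1)] by (metis Union_components)
  have cell: "\<exists>s \<Phi> M. s > 1 \<and> \<Phi> holomorphic_on ball 0 s \<and> inj_on \<Phi> (ball 0 s) \<and>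
    \<Phi> ` ball 0 s \<subseteq> M \<and> compact M \<and> M \<subseteq> C \<and> L \<inter> C \<subseteq> \<Phi> ` cball 0 1" if C: "C \<in> J" for C
  proof -
    have CU: "C \<in> components U" using C J(1) by blast
    have "L \<inter> C = L - \<Union>(components U - {C})"
    proof -
      have "C' \<inter> C = {}" if "C' \<in> components U" "C' \<noteq> C" for C'
        using components_nonoverlap[OF that(1) CU] that(2) by blast
      moreover have "L \<subseteq> \<Union>(components U)" using L(2) Union_components by metis
      ultimately show ?thesis using CU by blast
    qed
    moreover have "open (\<Union>(components U - {C}))" using open_components[OF U(1)] by (intro open_Union) auto
    ultimately have "compact (L \<inter> C)" using L(1) by (metis compact_diff)
    then show ?thesis
      using riemann_cell[OF open_components[OF U(1) CU] U(2)[OF CU] in_components_nonempty[OF CU], of "L \<inter> C"]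
      by (metis Int_lower2)
  qed
  obtain F where "\<forall>C\<in>J. case F C of (s, \<Phi>, M) \<Rightarrow> s > 1 \<and> \<Phi> holomorphic_on ball 0 s \<and> inj_on \<Phi> (ball 0 s) \<and>
    \<Phi> ` ball 0 s \<subseteq> M \<and> compact M \<and> M \<subseteq> C \<and> L \<inter> C \<subseteq> \<Phi> ` cball 0 1"
    using bchoice[of J "\<lambda>C (s, \<Phi>, M). s > 1 \<and> \<Phi> holomorphic_on ball 0 s \<and> inj_on \<Phi> (ball 0 s) \<and>
    \<Phi> ` ball 0 s \<subseteq> M \<and> compact M \<and> M \<subseteq> C \<and> L \<inter> C \<subseteq> \<Phi> ` cball 0 1"] cell by auto
  then obtain s :: "complex set \<Rightarrow> real" and \<Phi> M where s: "\<And>C. C \<in> J \<Longrightarrow> s C > 1"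
    and \<Phi>: "\<And>C. C \<in> J \<Longrightarrow> \<Phi> C holomorphic_on ball 0 (s C)" "\<And>C. C \<in> J \<Longrightarrow> inj_on (\<Phi> C) (ball 0 (s C))"
    and M: "\<And>C. C \<in> J \<Longrightarrow> \<Phi> C ` ball 0 (s C) \<subseteq> M C" "\<And>C. C \<in> J \<Longrightarrow> compact (M C)"
      "\<And>C. C \<in> J \<Longrightarrow> M C \<subseteq> C"
    and cov: "\<And>C. C \<in> J \<Longrightarrow> L \<inter> C \<subseteq> \<Phi> C ` cball 0 1"
    using that[of "\<lambda>C. fst (F C)" "\<lambda>C. fst (snd (F C))" "\<lambda>C. snd (snd (F C))"]
    by (simp add: case_prod_unfold)
  have CU: "C \<subseteq> U" if "C \<in> J" for C using that J(1) in_components_subset by blast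
  show ?thesis
  proof (rule that[of "\<Union>C\<in>J. M C"])
    show "compact (\<Union>C\<in>J. M C)" using J(2) M(2) by (rule compact_UN)
    show "(\<Union>C\<in>J. M C) \<subseteq> U" using M(3) CU by blast
    fix \<Omega> K :: "complex set" and P t g :: "complex \<Rightarrow> complex" and e :: real
    assume K: "runge_compact \<Omega> K" and P: "P holomorphic_on U" "inj_on P U" "P ` U \<subseteq> \<Omega>"
      "P ` (\<Union>C\<in>J. M C) \<inter> K = {}" and t: "t holomorphic_on U" and g: "g holomorphic_on \<Omega>" and e: "e > 0"
    define \<Psi> where "\<Psi> = (\<lambda>C w. P (\<Phi> C w))"
    have img: "\<Phi> C ` ball 0 (s C) \<subseteq> C" if "C \<in> J" for C using M(1,3) that by blast
    have imgU: "\<Phi> C ` ball 0 (s C) \<subseteq> U" if "C \<in> J" for C using img CU that by blast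
    have hol: "(\<lambda>w. F (\<Phi> C w)) holomorphic_on ball 0 (s C)" if "F holomorphic_on U" "C \<in> J" for F C
      using holomorphic_on_compose_gen[OF \<Phi>(1)[OF that(2)] that(1)] imgU[OF that(2)]
      by (simp add: o_def image_subset_iff_funcset)
    have "\<exists>h. h holomorphic_on \<Omega> \<and> (\<forall>z\<in>K. cmod (h z - g z) < e) \<and>
        (\<forall>C\<in>J. \<forall>w\<in>cball 0 1. cmod (h (\<Psi> C w) - t (\<Phi> C w)) < e)"
    proof (rule conjunct2[OF finite_cells_approximation[where s = s]])
      show "inj_on (\<Psi> C) (ball 0 (s C))" if "C \<in> J" for C
        using comp_inj_on[OF \<Phi>(2)[OF that] inj_on_subset[OF P(2) imgU[OF that]]]
        by (simp add: \<Psi>_def o_def)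
      show "\<Psi> C ` ball 0 (s C) \<subseteq> \<Omega>" if "C \<in> J" for C
        using imgU[OF that] P(3) by (auto simp: \<Psi>_def)
      show "K \<inter> \<Psi> C ` ball 0 (s C) = {}" if "C \<in> J" for C
        using M(1)[OF that] P(4) that by (fastforce simp: \<Psi>_def)
      show "disjoint_family_on (\<lambda>C. \<Psi> C ` ball 0 (s C)) J"
        unfolding disjoint_family_on_def
      proof (intro ballI impI)
        fix A B assume AB: "A \<in> J" "B \<in> J" "A \<noteq> B"
        then have "A \<inter> B = {}" using components_nonoverlap[of A U B] J(1) by blast
        then have "P ` A \<inter> P ` B = {}" using inj_on_image_Int[OF P(2) CU CU] AB by blast
        moreover have sub: "\<Psi> C ` ball 0 (s C) \<subseteq> P ` C" if "C \<in> J" for C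
          using img[OF that] by (auto simp: \<Psi>_def)
        ultimately show "\<Psi> A ` ball 0 (s A) \<inter> \<Psi> B ` ball 0 (s B) = {}"
          using sub[OF AB(1)] sub[OF AB(2)] by blast
      qed
      show "\<Psi> C holomorphic_on ball 0 (s C)" if "C \<in> J" for C
        using hol[OF P(1) that] by (simp add: \<Psi>_def)
    qed (use J(2) K s hol[OF t] g e in simp_all)
    then obtain h where h: "h holomorphic_on \<Omega>" "\<forall>z\<in>K. cmod (h z - g z) < e"
      "\<And>C w. C \<in> J \<Longrightarrow> w \<in> cball 0 1 \<Longrightarrow> cmod (h (\<Psi> C w) - t (\<Phi> C w)) < e" by blast
    have "cmod (h (P z) - t z) < e" if z: "z \<in> L" for z
    proof -
      obtain C w where "C \<in> J" "w \<in> cball 0 1" "z = \<Phi> C w" using J(3) cov z by blast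
      then show ?thesis using h(3) by (simp add: \<Psi>_def)
    qed
    then show "\<exists>h. h holomorphic_on \<Omega> \<and> (\<forall>z\<in>K. cmod (h z - g z) < e) \<and> (\<forall>z\<in>L. cmod (h (P z) - t z) < e)"
      using h(1,2) by blast
  qed
qed

text \<open>A Taylor polynomial whose coefficients are moved into \<open>Q\<close>; the list is its coefficient list.\<close>

lemma entire_approx_by_dense_coefficients:
  assumes h: "h holomorphic_on UNIV" and L: "compact L" and e: "e > 0"
    and Q: "\<And>T :: complex set. open T \<Longrightarrow> T \<noteq> {} \<Longrightarrow> \<exists>q\<in>Q. q \<in> T"
  obtains xs where "xs \<in> lists Q" "\<And>z. z \<in> L \<Longrightarrow> cmod ((\<Sum>i<length xs. xs ! i * z ^ i) - h z) < e"
proof -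
  obtain R where R: "R > 0" "\<And>z. z \<in> L \<Longrightarrow> cmod z \<le> R"
    using compact_imp_bounded[OF L] by (auto simp: bounded_pos)
  define a where "a = fps_nth (fps_expansion h 0)"
  have rad: "fps_conv_radius (fps_expansion h 0) \<ge> \<infinity>"
    by (rule conv_radius_fps_expansion) (use h in simp)
  then have "ereal R < conv_radius a"
    by (simp add: a_def fps_conv_radius_def)
  from powser_uniform_limit[OF this, of 0]
  have "uniform_limit (cball 0 R) (\<lambda>n x. \<Sum>i<n. a i * x ^ i) (\<lambda>x. suminf (\<lambda>i. a i * x ^ i)) sequentially"
    by simp
  moreover have "suminf (\<lambda>i. a i * x ^ i) = h x" for x
    using eval_fps_expansion'[of h 0 \<infinity> x] h by (simp add: eval_fps_def a_def)
  ultimately have "uniform_limit (cball 0 R) (\<lambda>n x. \<Sum>i<n. a i * x ^ i) h sequentially"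
    by simp
  then have "\<forall>\<^sub>F n in sequentially. \<forall>x\<in>cball 0 R. dist (\<Sum>i<n. a i * x ^ i) (h x) < e / 2"
    by (rule uniform_limitD) (use e in simp)
  then obtain n where n: "\<And>x. x \<in> cball 0 R \<Longrightarrow> cmod ((\<Sum>i<n. a i * x ^ i) - h x) < e / 2"
    unfolding eventually_sequentially dist_norm by blast
  \<comment> \<open>each of the \<open>n\<close> terms then contributes at most \<open>e / (2 (n + 1))\<close> on the disc of radius \<open>R\<close>\<close>
  define \<delta> where "\<delta> = (\<lambda>i. e / (2 * (real n + 1) * R ^ i))"
  have \<delta>: "\<delta> i > 0" for i using e R(1) by (simp add: \<delta>_def)
  have "\<exists>q\<in>Q. q \<in> ball (a i) (\<delta> i)" for i using \<delta>[of i] by (intro Q) auto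
  then obtain q where q: "\<And>i. q i \<in> Q" "\<And>i. cmod (q i - a i) < \<delta> i"
    by (metis dist_commute dist_norm mem_ball)
  show ?thesis
  proof (rule that[of "map q [0..<n]"])
    show "map q [0..<n] \<in> lists Q" using q(1) by auto
    fix z assume z: "z \<in> L"
    have "cmod ((\<Sum>i<n. q i * z ^ i) - (\<Sum>i<n. a i * z ^ i)) \<le> (\<Sum>i<n. e / (2 * (real n + 1)))"
      unfolding sum_subtractf[symmetric]
    proof (rule sum_norm_le)
      fix i assume "i \<in> {..<n}"
      have "cmod (q i * z ^ i - a i * z ^ i) = cmod (q i - a i) * cmod z ^ i"
        by (simp flip: left_diff_distrib add: norm_mult norm_power)
      also have "\<dots> \<le> \<delta> i * R ^ i"
        using q(2)[of i] R(1) R(2)[OF z] \<delta>[of i] by (intro mult_mono power_mono) auto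
      also have "\<dots> = e / (2 * (real n + 1))" using R(1) by (simp add: \<delta>_def)
      finally show "cmod (q i * z ^ i - a i * z ^ i) \<le> e / (2 * (real n + 1))" .
    qed
    also have "\<dots> \<le> e / 2" using e by (simp add: field_simps)
    finally have "cmod ((\<Sum>i<n. q i * z ^ i) - h z) < e"
      using norm_triangle_ineq[of "(\<Sum>i<n. q i * z ^ i) - (\<Sum>i<n. a i * z ^ i)" "(\<Sum>i<n. a i * z ^ i) - h z"]
        n[of z] R(2)[OF z] by simp
    then show "cmod ((\<Sum>i<length (map q [0..<n]). map q [0..<n] ! i * z ^ i) - h z) < e" by simp
  qed
qed

section \<open>Baire category for spaces of holomorphic functions\<close>

lemma in_holo_closure_ofI:
  assumes "g \<in> holo_space W"
    and "\<And>K e. compact K \<Longrightarrow> K \<subseteq> W \<Longrightarrow> e > 0 \<Longrightarrow> \<exists>h\<in>S. h \<in> holo_nbhd W g K e"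
  shows "g \<in> holo_topology W closure_of S"
  unfolding in_closure_of topspace_holo_topology openin_holo_topology
  using assms unfolding holo_open_def by (metis subsetD)

lemma restrict_in_holo_space:
  assumes "h holomorphic_on W"
  shows "restrict h W \<in> holo_space W"
proof -
  have "restrict h W holomorphic_on W \<longleftrightarrow> h holomorphic_on W"
    by (rule holomorphic_cong) auto
  then show ?thesis using assms by (simp add: holo_space_def)
qed

text \<open>The usual nested construction, carried out on triples of a centre, a compact set and a radius.
The compact sets absorb an exhaustion of \<open>W\<close> and the radii at least halve, so the centres
converge locally uniformly.\<close>

lemma holo_space_Baire:
  fixes \<O> :: "nat \<Rightarrow> (complex \<Rightarrow> complex) set"
  assumes W: "open W" and \<O>: "\<And>n. holo_open W (\<O> n)"
    and dense: "\<And>n g K e. \<lbrakk>g \<in> holo_space W; compact K; K \<subseteq> W; e > 0\<rbrakk> \<Longrightarrow> \<exists>h\<in>\<O> n. h \<in> holo_nbhd W g K e"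
    and g: "g \<in> holo_space W" and K: "compact K" "K \<subseteq> W" and e: "e > 0"
  obtains h where "\<And>n. h \<in> \<O> n" "h \<in> holo_nbhd W g K e"
proof -
  obtain C where C: "\<And>n::nat. compact (C n)" "\<And>n. C n \<subseteq> W"
    "\<And>K. \<lbrakk>compact K; K \<subseteq> W\<rbrakk> \<Longrightarrow> \<exists>N. \<forall>n\<ge>N. K \<subseteq> C n"
    using open_Union_compact_subsets[OF W] by metis
  define P where "P = (\<lambda>(n::nat) (g, K, e). g \<in> holo_space W \<and> compact K \<and> K \<subseteq> W \<and> (e::real) > 0)"
  \<comment> \<open>the room between \<open>e'\<close> and \<open>e1\<close> keeps the limit, which satisfies only weak inequalities, in the open set\<close>
  define Q where "Q = (\<lambda>n (g, K, e) (g', K', e'). (\<forall>z\<in>K. cmod (g' z - g z) < e / 2) \<and> K \<union> C n \<subseteq> K' \<and>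
     e' \<le> e / 2 \<and> (\<exists>e1>e'. holo_nbhd W g' K' e1 \<subseteq> \<O> n))"
  define P0 where "P0 = (\<lambda>n x. P n x \<and> (n = 0 \<longrightarrow> x = (g, K, e / 2)))"
  have step: "\<exists>y. P0 (Suc n) y \<and> Q n x y" if x: "P0 n x" for n x
  proof -
    obtain g K e where [simp]: "x = (g, K, e)" by (cases x)
    have gK: "g \<in> holo_space W" "compact K" "K \<subseteq> W" "e / 2 > 0" using x by (auto simp: P0_def P_def)
    then obtain h where h: "h \<in> \<O> n" "h \<in> holo_nbhd W g K (e / 2)" using dense by blast
    obtain K1 e1 where K1: "compact K1" "K1 \<subseteq> W" "e1 > 0" "holo_nbhd W h K1 e1 \<subseteq> \<O> n"
      using \<O>[of n] h(1) unfolding holo_open_def by blast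
    define y where "y = (h, K \<union> C n \<union> K1, min (e / 2) (e1 / 2))"
    have "holo_nbhd W h (K \<union> C n \<union> K1) e1 \<subseteq> \<O> n" using K1(4) by (auto simp: holo_nbhd_def)
    moreover have "min (e / 2) (e1 / 2) < e1" using K1(3) by linarith
    ultimately have "Q n x y" using h(2) by (auto simp: Q_def y_def holo_nbhd_def)
    moreover have "P0 (Suc n) y" using h gK K1 C(1,2)[of n]
      by (auto simp: P0_def P_def y_def holo_nbhd_def intro!: compact_Un)
    ultimately show ?thesis by blast
  qed
  have init: "\<exists>x. P0 0 x"
    using g K e by (intro exI[of _ "(g, K, e / 2)"]) (auto simp: P0_def P_def)
  have "\<exists>x. \<forall>n. P0 n (x n) \<and> Q n (x n) (x (Suc n))"
    using init step by (rule dependent_nat_choice)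
  then obtain x where x: "\<And>n. P0 n (x n)" "\<And>n. Q n (x n) (x (Suc n))" by blast
  define G where "G = (\<lambda>n. fst (x n))"
  define L where "L = (\<lambda>n. fst (snd (x n)))"
  define d where "d = (\<lambda>n. snd (snd (x n)))"
  have xn: "x n = (G n, L n, d n)" for n by (simp add: G_def L_def d_def)
  have inv: "G n \<in> holo_space W" "compact (L n)" "L n \<subseteq> W" "d n > 0" for n
    using x(1)[of n] by (auto simp: xn P0_def P_def)
  have start: "G 0 = g" "L 0 = K" "d 0 = e / 2" using x(1)[of 0] by (auto simp: xn P0_def)
  have next1: "\<And>z. z \<in> L n \<Longrightarrow> cmod (G (Suc n) z - G n z) < d n / 2"
    and next2: "L n \<subseteq> L (Suc n)" "C n \<subseteq> L (Suc n)" "d (Suc n) \<le> d n / 2"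
    and next3: "\<exists>e1>d (Suc n). holo_nbhd W (G (Suc n)) (L (Suc n)) e1 \<subseteq> \<O> n" for n
    using x(2)[of n] by (auto simp: xn Q_def)
  have L_mono: "L n \<subseteq> L m" if "n \<le> m" for n m
    using that next2(1) by (rule lift_Suc_mono_le[rotated])
  \<comment> \<open>since \<open>d j / 2 \<le> d j - d (j + 1)\<close>, the steps telescope\<close>
  have near: "cmod (G m z - G n z) \<le> d n - d m" if "n \<le> m" "z \<in> L n" for n m z
    using that(1)
  proof (induction m rule: dec_induct)
    case base show ?case by simp
  next
    case (step m)
    have "z \<in> L m" using that(2) L_mono[OF step.hyps(1)] by blast
    then have "cmod (G (Suc m) z - G m z) < d m / 2" by (rule next1)
    then show ?case
      using norm_triangle_ineq[of "G (Suc m) z - G m z" "G m z - G n z"] step.IH next2(3)[of m] by simp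
  qed
  have d_small: "d n \<le> d 0 * (1 / 2) ^ n" for n
  proof (induction n)
    case (Suc n) then show ?case using next2(3)[of n] by simp
  qed simp
  have d0: "d \<longlonglongrightarrow> 0"
  proof (rule tendsto_sandwich[OF _ _ tendsto_const])
    show "(\<lambda>n. d 0 * (1 / 2) ^ n) \<longlonglongrightarrow> 0"
      by (intro tendsto_mult_right_zero LIMSEQ_power_zero) simp
  qed (use inv(4) d_small in \<open>auto intro!: always_eventually less_imp_le\<close>)
  have exhaust: "\<exists>n. z \<in> L n" if "z \<in> W" for z
    using C(3)[of "{z}"] that next2(2) by (metis compact_sing empty_subsetI insert_subset le_refl subsetD)
  have conv: "convergent (\<lambda>n. G n z)" if z: "z \<in> W" for z
  proof (intro Cauchy_convergent metric_CauchyI)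
    fix r :: real assume r: "r > 0"
    obtain N where N: "z \<in> L N" using exhaust z by blast
    obtain N' where N': "\<And>n. n \<ge> N' \<Longrightarrow> d n < r / 2"
      using order_tendstoD(2)[OF d0, of "r / 2"] r by (auto simp: eventually_sequentially)
    define M where "M = max N N'"
    have zM: "z \<in> L M" using N L_mono[of N M] by (auto simp: M_def)
    have *: "cmod (G n z - G M z) < r / 2" if "n \<ge> M" for n
      using near[OF that zM] N'[of M] inv(4)[of n] by (simp add: M_def)
    have "dist (G m z) (G n z) < r" if "m \<ge> M" "n \<ge> M" for m n
      using norm_triangle_ineq4[of "G m z - G M z" "G n z - G M z"] *[OF that(1)] *[OF that(2)]
      by (simp add: dist_norm)
    then show "\<exists>M. \<forall>m\<ge>M. \<forall>n\<ge>M. dist (G m z) (G n z) < r" by blast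
  qed
  define l where "l = (\<lambda>z. lim (\<lambda>n. G n z))"
  have lim: "(\<lambda>n. G n z) \<longlonglongrightarrow> l z" if "z \<in> W" for z
    using conv[OF that] by (simp add: l_def convergent_LIMSEQ_iff)
  have l_near: "cmod (l z - G n z) \<le> d n" if z: "z \<in> L n" for n z
  proof (rule tendsto_upperbound)
    show "(\<lambda>m. cmod (G m z - G n z)) \<longlonglongrightarrow> cmod (l z - G n z)"
      using lim inv(3) z by (intro tendsto_intros) auto
    show "\<forall>\<^sub>F m in sequentially. cmod (G m z - G n z) \<le> d n"
      using eventually_ge_at_top[of n]
    proof eventually_elim
      case (elim m)
      show ?case using near[OF elim z] inv(4)[of m] by simp
    qed
  qed simp
  have "l holomorphic_on W"
  proof (rule holomorphic_uniform_sequence[OF W, of G])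
    show "G n holomorphic_on W" for n using inv(1) by (simp add: holo_space_def)
    fix z assume "z \<in> W"
    then obtain r where r: "r > 0" "cball z r \<subseteq> W" using W open_contains_cball by blast
    obtain N where N: "\<And>n. n \<ge> N \<Longrightarrow> cball z r \<subseteq> C n" using C(3)[of "cball z r"] r(2) by auto
    have sub: "cball z r \<subseteq> L n" if "n \<ge> Suc N" for n
      using N[of N] next2(2)[of N] L_mono[OF that] by auto
    have "uniform_limit (cball z r) G l sequentially"
      unfolding uniform_limit_iff
    proof (intro allI impI)
      fix t :: real assume t: "t > 0"
      have "\<forall>\<^sub>F n in sequentially. d n < t" using order_tendstoD(2)[OF d0 t] .
      moreover have "\<forall>\<^sub>F n in sequentially. n \<ge> Suc N" by (rule eventually_ge_at_top)
      ultimately show "\<forall>\<^sub>F n in sequentially. \<forall>y\<in>cball z r. dist (G n y) (l y) < t"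
      proof eventually_elim
        case (elim n)
        show ?case
        proof
          fix y assume "y \<in> cball z r"
          then have "y \<in> L n" using sub[OF elim(2)] by blast
          from l_near[OF this] show "dist (G n y) (l y) < t"
            using elim(1) by (simp add: dist_norm norm_minus_commute)
        qed
      qed
    qed
    with r show "\<exists>d>0. cball z d \<subseteq> W \<and> uniform_limit (cball z d) G l sequentially" by blast
  qed
  then have hW: "restrict l W \<in> holo_space W" by (rule restrict_in_holo_space)
  show ?thesis
  proof (rule that[of "restrict l W"])
    show "restrict l W \<in> \<O> n" for n
    proof -
      obtain e1 where e1: "e1 > d (Suc n)" "holo_nbhd W (G (Suc n)) (L (Suc n)) e1 \<subseteq> \<O> n"
        using next3 by blast
      have "cmod (restrict l W z - G (Suc n) z) < e1" if "z \<in> L (Suc n)" for z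
        using l_near[OF that] inv(3) that e1(1) by (simp add: subset_iff)
      then show ?thesis using e1(2) hW by (auto simp: holo_nbhd_def)
    qed
    have "cmod (restrict l W z - g z) < e" if "z \<in> K" for z
      using l_near[of z 0] that e K(2) by (auto simp: start)
    then show "restrict l W \<in> holo_nbhd W g K e" using hW by (auto simp: holo_nbhd_def)
  qed
qed

lemma comeager_in_holo_topologyI:
  assumes W: "open W" and I: "countable I" "I \<noteq> {}" and \<O>: "\<And>i. i \<in> I \<Longrightarrow> holo_open W (\<O> i)"
    and dense: "\<And>i g K e. \<lbrakk>i \<in> I; g \<in> holo_space W; compact K; K \<subseteq> W; e > 0\<rbrakk> \<Longrightarrow>
      \<exists>h\<in>\<O> i. h \<in> holo_nbhd W g K e"
    and sub: "(\<Inter>i\<in>I. \<O> i) \<subseteq> A" and A: "A \<subseteq> holo_space W"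
  shows "comeager_in (holo_topology W) A"
  unfolding comeager_in_def
proof (intro conjI exI[of _ "\<Inter>i\<in>I. \<O> i"])
  show "A \<subseteq> topspace (holo_topology W)" using A by (simp add: topspace_holo_topology)
  show "(\<Inter>i\<in>I. \<O> i) \<subseteq> A" by (rule sub)
  show "gdelta_in (holo_topology W) (\<Inter>i\<in>I. \<O> i)"
    using I \<O> by (intro gdelta_in_Inter) (auto intro!: open_imp_gdelta_in simp: openin_holo_topology)
  show "holo_topology W closure_of (\<Inter>i\<in>I. \<O> i) = topspace (holo_topology W)"
  proof (rule antisym[OF closure_of_subset_topspace], rule subsetI)
    fix g assume "g \<in> topspace (holo_topology W)"
    then have g: "g \<in> holo_space W" by (simp add: topspace_holo_topology)
    then show "g \<in> holo_topology W closure_of (\<Inter>i\<in>I. \<O> i)"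
    proof (rule in_holo_closure_ofI)
      fix K :: "complex set" and e :: real assume K: "compact K" "K \<subseteq> W" "e > 0"
      have r: "range (from_nat_into I) = I" using I by (rule range_from_nat_into[rotated])
      have m: "from_nat_into I n \<in> I" for n using I(2) by (rule from_nat_into)
      obtain h where h: "\<And>n. h \<in> \<O> (from_nat_into I n)" "h \<in> holo_nbhd W g K e"
        using holo_space_Baire[OF W, of "\<lambda>n. \<O> (from_nat_into I n)", OF \<O>[OF m] dense[OF m] g K] by blast
      have "h \<in> \<O> i" if "i \<in> I" for i using h(1) r that by (metis rangeE)
      then show "\<exists>h\<in>\<Inter>i\<in>I. \<O> i. h \<in> holo_nbhd W g K e" using h(2) by blast
    qed
  qed
qed

section \<open>Generic universality\<close>

text \<open>On the compact set \<open>L\<close> the strict inequality holds with a margin, and the margin may be spent on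
perturbing \<open>g\<close> over the compact set \<open>F n ` L\<close>.\<close>

lemma holo_open_hitting:
  assumes L: "compact L" and F: "\<And>n. n \<ge> (1::nat) \<Longrightarrow> continuous_on L (F n)" "\<And>n. n \<ge> 1 \<Longrightarrow> F n ` L \<subseteq> W"
    and p: "continuous_on L p"
  shows "holo_open W {g \<in> holo_space W. \<exists>n\<ge>1. \<forall>z\<in>L. cmod (g (F n z) - p z) < e}"
  unfolding holo_open_def
proof (intro conjI ballI)
  fix g assume "g \<in> {g \<in> holo_space W. \<exists>n\<ge>1. \<forall>z\<in>L. cmod (g (F n z) - p z) < e}"
  then obtain n where g: "g \<in> holo_space W" and n: "n \<ge> 1" and lt: "\<And>z. z \<in> L \<Longrightarrow> cmod (g (F n z) - p z) < e"
    by blast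
  have "\<exists>d>0. \<forall>z\<in>L. cmod (g (F n z) - p z) \<le> e - d"
  proof (cases "L = {}")
    case True then show ?thesis by (auto intro: exI[of _ 1])
  next
    case False
    have "continuous_on W g" using g by (simp add: holo_space_def holomorphic_on_imp_continuous_on)
    then have "continuous_on L (\<lambda>z. cmod (g (F n z) - p z))"
      by (intro continuous_intros continuous_on_compose2[OF _ F(1)[OF n]] p) (use F(2)[OF n] in auto)
    from continuous_attains_sup[OF L False this] obtain w where "w \<in> L"
      "\<And>z. z \<in> L \<Longrightarrow> cmod (g (F n z) - p z) \<le> cmod (g (F n w) - p w)" by blast
    then show ?thesis using lt[of w] by (intro exI[of _ "e - cmod (g (F n w) - p w)"]) auto
  qed
  then obtain d where d: "d > 0" "\<And>z. z \<in> L \<Longrightarrow> cmod (g (F n z) - p z) \<le> e - d" by blast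
  show "\<exists>K \<epsilon>. compact K \<and> K \<subseteq> W \<and> \<epsilon> > 0 \<and>
      holo_nbhd W g K \<epsilon> \<subseteq> {g \<in> holo_space W. \<exists>n\<ge>1. \<forall>z\<in>L. cmod (g (F n z) - p z) < e}"
  proof (intro exI[of _ "F n ` L"] exI[of _ d] conjI)
    show "compact (F n ` L)" using F(1)[OF n] L by (rule compact_continuous_image)
    show "F n ` L \<subseteq> W" using F(2)[OF n] .
    show "holo_nbhd W g (F n ` L) d \<subseteq> {g \<in> holo_space W. \<exists>n\<ge>1. \<forall>z\<in>L. cmod (g (F n z) - p z) < e}"
    proof
      fix h assume h: "h \<in> holo_nbhd W g (F n ` L) d"
      have "cmod (h (F n z) - p z) < e" if z: "z \<in> L" for z
      proof -
        have "cmod (h (F n z) - g (F n z)) < d" using h z by (simp add: holo_nbhd_def)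
        then show ?thesis
          using norm_triangle_ineq[of "h (F n z) - g (F n z)" "g (F n z) - p z"] d(2)[OF z] by simp
      qed
      then show "h \<in> {g \<in> holo_space W. \<exists>n\<ge>1. \<forall>z\<in>L. cmod (g (F n z) - p z) < e}"
        using h n by (auto simp: holo_nbhd_def)
    qed
  qed (use d(1) in simp)
qed auto

theorem theorem2p2:
  fixes D \<Omega> U :: "complex set" and f :: "complex \<Rightarrow> complex"
  assumes "open D"
    and "open \<Omega>" and "connected \<Omega>" and "\<Omega> \<noteq> {}"
    and "D \<subseteq> \<Omega>"
    and "f holomorphic_on D" and "f \<in> D \<rightarrow> D"
    and "U \<in> U0_dyn D \<Omega> f"
  shows "comeager_in (holo_topology \<Omega>) {g. universal_on \<Omega> U f g}"
proof -
  have U: "open U" "\<nexists>H. is_hole U H" "U \<subseteq> D"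
    and leave: "locally_uniform_limit U (\<lambda>n z. infdist (Fin ((f ^^ n) z)) (boundary_inf \<Omega>)) (\<lambda>_. 0)"
    and inj: "\<And>n. n \<ge> 1 \<Longrightarrow> inj_on (f ^^ n) U"
    using assms(8) by (auto simp: U0_dyn_def U0_def)
  have sc: "simply_connected C" if "C \<in> components U" for C
    using simply_connected_components_of_no_holes[OF U(1,2) that] .
  have iter: "(f ^^ n) holomorphic_on D \<and> (f ^^ n) ` D \<subseteq> D" for n
  proof (induction n)
    case 0 show ?case by (simp add: id_def[symmetric])
  next
    case (Suc n)
    have "(f \<circ> (f ^^ n)) holomorphic_on D"
      using Suc assms(6) by (intro holomorphic_on_compose_gen[of _ _ _ D]) (auto simp: image_subset_iff_funcset)
    moreover have "(f ^^ Suc n) ` D \<subseteq> D" using Suc assms(7) by auto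
    ultimately show ?case by (simp only: funpow.simps simp_thms)
  qed
  have fU: "(f ^^ n) holomorphic_on U" "(f ^^ n) ` U \<subseteq> \<Omega>" for n
    using iter[of n] U(3) assms(5) by (auto intro: holomorphic_on_subset)
  obtain L where L: "\<And>m::nat. compact (L m)" "\<And>m. L m \<subseteq> U"
    "\<And>K. \<lbrakk>compact K; K \<subseteq> U\<rbrakk> \<Longrightarrow> \<exists>N. \<forall>m\<ge>N. K \<subseteq> L m"
    using open_Union_compact_subsets[OF U(1)] by metis
  obtain Q :: "complex set" where Q: "countable Q" "\<And>T. open T \<Longrightarrow> T \<noteq> {} \<Longrightarrow> \<exists>q\<in>Q. q \<in> T"
    using countable_dense_exists[where ?'a = complex] by metis
  define p :: "complex list \<Rightarrow> complex \<Rightarrow> complex" where "p = (\<lambda>xs z. \<Sum>i<length xs. xs ! i * z ^ i)"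
  have p_hol: "p xs holomorphic_on S" for xs S unfolding p_def by (intro holomorphic_intros)
  define I where "I = lists Q \<times> (UNIV :: nat set) \<times> (UNIV :: nat set)"
  define \<O> where "\<O> = (\<lambda>(xs, m, q). {g \<in> holo_space \<Omega>. \<exists>n\<ge>1. \<forall>z\<in>L m. cmod (g ((f ^^ n) z) - p xs z) < 1 / real (Suc q)})"
  show ?thesis
  proof (rule comeager_in_holo_topologyI[OF assms(2), of I \<O>])
    show "countable I" using Q(1) by (simp add: I_def)
    show "I \<noteq> {}" using Cons_in_lists_iff by (auto simp: I_def)
    show "{g. universal_on \<Omega> U f g} \<subseteq> holo_space \<Omega>" by (auto simp: universal_on_def)
    fix i assume "i \<in> I"
    obtain xs m q where i: "i = (xs, m, q)" by (cases i)
    show "holo_open \<Omega> (\<O> i)"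
      unfolding \<O>_def i prod.case
    proof (rule holo_open_hitting[OF L(1)])
      show "continuous_on (L m) (f ^^ n)" for n
        using fU(1) L(2) by (meson continuous_on_subset holomorphic_on_imp_continuous_on)
      show "(f ^^ n) ` L m \<subseteq> \<Omega>" for n using fU(2) L(2) by blast
      show "continuous_on (L m) (p xs)" using p_hol by (rule holomorphic_on_imp_continuous_on)
    qed
    fix g K and e :: real assume g: "g \<in> holo_space \<Omega>" and K: "compact K" "K \<subseteq> \<Omega>" and e: "e > 0"
    obtain K' where K': "runge_compact \<Omega> K'" "K \<subseteq> K'" using runge_compact_hull[OF assms(2) K] by blast
    show "\<exists>h\<in>\<O> i. h \<in> holo_nbhd \<Omega> g K e"
    proof (rule simultaneous_approximation[OF U(1) sc L(1) L(2), of m])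
      fix M assume M: "compact M" "M \<subseteq> U"
        "\<And>\<Omega> K P t g e. \<lbrakk>runge_compact \<Omega> K; P holomorphic_on U; inj_on P U; P ` U \<subseteq> \<Omega>; P ` M \<inter> K = {};
          t holomorphic_on U; g holomorphic_on \<Omega>; e > 0\<rbrakk> \<Longrightarrow>
        \<exists>h. h holomorphic_on \<Omega> \<and> (\<forall>z\<in>K. cmod (h z - g z) < e) \<and> (\<forall>z\<in>L m. cmod (h (P z) - t z) < e)"
      have "\<forall>\<^sub>F n in sequentially. (f ^^ n) ` M \<inter> K' = {}"
        using K'(1) by (intro iterates_leave_compact[OF assms(2) _ _ leave M(1,2)]) (auto simp: runge_compact_def)
      then obtain N where "\<And>n. n \<ge> N \<Longrightarrow> (f ^^ n) ` M \<inter> K' = {}" by (auto simp: eventually_sequentially)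
      \<comment> \<open>\<open>Suc N\<close> rather than \<open>N\<close>, because universality counts only iterates with \<open>n \<ge> 1\<close>\<close>
      then have n: "(f ^^ Suc N) ` M \<inter> K' = {}" by (metis le_SucI order_refl)
      have inj': "inj_on (f ^^ Suc N) U" by (rule inj) simp
      have "min e (1 / real (Suc q)) > 0" using e by simp
      from M(3)[OF K'(1) fU(1) inj' fU(2) n p_hol[of xs] _ this, of g] g
      obtain h where h: "h holomorphic_on \<Omega>" "\<forall>z\<in>K'. cmod (h z - g z) < min e (1 / real (Suc q))"
        "\<forall>z\<in>L m. cmod (h ((f ^^ Suc N) z) - p xs z) < min e (1 / real (Suc q))"
        by (auto simp: holo_space_def)
      have hr: "restrict h \<Omega> \<in> holo_space \<Omega>" using h(1) by (rule restrict_in_holo_space)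
      have "cmod (restrict h \<Omega> ((f ^^ Suc N) z) - p xs z) < 1 / real (Suc q)" if z: "z \<in> L m" for z
      proof -
        have "(f ^^ Suc N) z \<in> \<Omega>" using fU(2)[of "Suc N"] L(2) z by blast
        then show ?thesis using h(3) z by (simp del: funpow.simps)
      qed
      then have "restrict h \<Omega> \<in> \<O> i" using hr unfolding \<O>_def i prod.case by (intro CollectI conjI exI[of _ "Suc N"]) auto
      moreover have "restrict h \<Omega> \<in> holo_nbhd \<Omega> g K e"
        using hr h(2) K'(2) K(2) by (auto simp: holo_nbhd_def subset_iff)
      ultimately show "\<exists>h\<in>\<O> i. h \<in> holo_nbhd \<Omega> g K e" by blast
    qed
  next
    show "(\<Inter>i\<in>I. \<O> i) \<subseteq> {g. universal_on \<Omega> U f g}"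
    proof
      fix g assume g: "g \<in> (\<Inter>i\<in>I. \<O> i)"
      \<comment> \<open>any index shows that \<open>g\<close> belongs to the space\<close>
      have "([], 0, 0) \<in> I" by (simp add: I_def)
      then have "g \<in> \<O> ([], 0, 0)" using g by blast
      then have g\<Omega>: "g \<in> holo_space \<Omega>" by (simp add: \<O>_def)
      let ?S = "{restrict (g \<circ> (f ^^ n)) U | n. n \<ge> 1}"
      have "t \<in> holo_topology U closure_of ?S" if t: "t \<in> holo_space U" for t
        using t
      proof (rule in_holo_closure_ofI)
        fix K :: "complex set" and e :: real assume K: "compact K" "K \<subseteq> U" and e: "e > 0"
        have e2: "e / 3 > 0" using e by simp
        obtain m where m: "K \<subseteq> L m" using L(3)[OF K] by blast
        show "\<exists>h\<in>?S. h \<in> holo_nbhd U t K e"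
        proof (rule simultaneous_approximation[OF U(1) sc L(1) L(2), of m])
          fix M assume M: "compact M" "M \<subseteq> U"
            "\<And>\<Omega> K P t g e. \<lbrakk>runge_compact \<Omega> K; P holomorphic_on U; inj_on P U; P ` U \<subseteq> \<Omega>; P ` M \<inter> K = {};
              t holomorphic_on U; g holomorphic_on \<Omega>; e > 0\<rbrakk> \<Longrightarrow>
            \<exists>h. h holomorphic_on \<Omega> \<and> (\<forall>z\<in>K. cmod (h z - g z) < e) \<and> (\<forall>z\<in>L m. cmod (h (P z) - t z) < e)"
          from M(3)[OF runge_compact_empty[of UNIV], where P = "\<lambda>z. z" and t = t and g = "\<lambda>_. 0" and e = "e / 3"] t e2
          obtain h where h: "h holomorphic_on UNIV" "\<And>z. z \<in> L m \<Longrightarrow> cmod (h z - t z) < e / 3"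
            by (auto simp: holo_space_def inj_on_def)
          obtain xs where xs: "xs \<in> lists Q" "\<And>z. z \<in> L m \<Longrightarrow> cmod (p xs z - h z) < e / 3"
            using entire_approx_by_dense_coefficients[OF h(1) L(1) e2 Q(2), of m] unfolding p_def by blast
          obtain q where q: "1 / real (Suc q) < e / 3" using e2 nat_approx_posE by blast
          have "(xs, m, q) \<in> I" using xs(1) by (simp add: I_def)
          then have "g \<in> \<O> (xs, m, q)" using g by blast
          then obtain n where n: "n \<ge> 1" "\<And>z. z \<in> L m \<Longrightarrow> cmod (g ((f ^^ n) z) - p xs z) < 1 / real (Suc q)"
            by (auto simp: \<O>_def)
          have "(g \<circ> (f ^^ n)) holomorphic_on U"
            using g\<Omega> fU[of n] by (intro holomorphic_on_compose_gen[of _ _ _ \<Omega>]) (auto simp: holo_space_def)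
          then have "restrict (g \<circ> (f ^^ n)) U \<in> holo_space U" by (rule restrict_in_holo_space)
          moreover have "cmod (restrict (g \<circ> (f ^^ n)) U z - t z) < e" if z: "z \<in> K" for z
          proof -
            have zL: "z \<in> L m" "z \<in> U" using z m K(2) by auto
            have "cmod (g ((f ^^ n) z) - t z)
              \<le> cmod (g ((f ^^ n) z) - p xs z) + cmod (p xs z - h z) + cmod (h z - t z)"
              using norm_triangle_ineq[of "g ((f ^^ n) z) - p xs z" "p xs z - h z"]
                norm_triangle_ineq[of "g ((f ^^ n) z) - h z" "h z - t z"] by simp
            then show ?thesis using n(2)[OF zL(1)] xs(2)[OF zL(1)] h(2)[OF zL(1)] q zL(2) by simp
          qed
          ultimately have "restrict (g \<circ> (f ^^ n)) U \<in> holo_nbhd U t K e" by (simp add: holo_nbhd_def)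
          then show "\<exists>h\<in>?S. h \<in> holo_nbhd U t K e" using n(1) by blast
        qed
      qed
      then have "holo_topology U closure_of ?S = holo_space U"
        using closure_of_subset_topspace[of "holo_topology U" ?S] by (auto simp: topspace_holo_topology)
      then show "g \<in> {g. universal_on \<Omega> U f g}" using g\<Omega> by (simp add: universal_on_def)
    qed
  qed
qed

end
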